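(* Let $A$ be an associative algebra and $M$ be an $A$-bimodule. For $n\ge 1$ let $\mathfrak g^n$ be the $\mathbb K$-module of all families $P=\oplus_{x_1,\dots,x_n\in X}P_{x_1,\dots,x_n}$ with $P_{x_1,\dots,x_n}\in\mathrm{Hom}(M^{\otimes n},A)$, and let $\mathfrak g^0=A$. Then the graded $\mathbb K$-module $\oplus_{n\ge 0}\mathfrak g^n$ inherits a graded Lie algebra structure (with $\mathfrak g^n$ in degree $n$) whose bracket is given as follows. For $P\in\mathfrak g^m$, $Q\in\mathfrak g^n$ with $m,n\ge 1$, $x_1,\dots,x_{m+n}\in X$ and $u_1,\dots,u_{m+n}\in M$, $$[\![P,Q]\!]_{x_1,\dots,x_{m+n}}(u_1,\dots,u_{m+n})$$ $$=\sum_{i=1}^m(-1)^{(i-1)n}P_{x_1,\dots,x_{i-1},x_{i+n},\dots,x_{m+n}}\big(u_1,\dots,u_{i-1},Q_{x_i,\dots,x_{i+n-1}}(u_i,\dots,u_{i+n-1})\cdot_M u_{i+n},\dots,u_{m+n}\big)$$ $$-\sum_{i=1}^m(-1)^{in}P_{x_1,\dots,x_i,x_{i+n+1},\dots,x_{m+n}}\big(u_1,\dots,u_{i-1},u_i\cdot_M Q_{x_{i+1},\dots,x_{i+n}}(u_{i+1},\dots,u_{i+n}),u_{i+n+1},\dots,u_{m+n}\big)$$ $$-(-1)^{mn}\Big\{\sum_{i=1}^n(-1)^{(i-1)m}Q_{x_1,\dots,x_{i-1},x_{i+m},\dots,x_{m+n}}\big(u_1,\dots,u_{i-1},P_{x_i,\dots,x_{i+m-1}}(u_i,\dots,u_{i+m-1})\cdot_M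 u_{i+m},\dots,u_{m+n}\big)$$ $$-\sum_{i=1}^n(-1)^{im}Q_{x_1,\dots,x_i,x_{i+m+1},\dots,x_{m+n}}\big(u_1,\dots,u_{i-1},u_i\cdot_M P_{x_{i+1},\dots,x_{i+m}}(u_{i+1},\dots,u_{i+m}),u_{i+m+1},\dots,u_{m+n}\big)\Big\}$$ $$+(-1)^{mn}\Big[P_{x_1,\dots,x_m}(u_1,\dots,u_m)\cdot Q_{x_{m+1},\dots,x_{m+n}}(u_{m+1},\dots,u_{m+n})-(-1)^{mn}Q_{x_1,\dots,x_n}(u_1,\dots,u_n)\cdot P_{x_{n+1},\dots,x_{m+n}}(u_{n+1},\dots,u_{m+n})\Big];$$ for $P\in\mathfrak g^m$ with $m\ge 1$ and $a\in A=\mathfrak g^0$, $$[\![P,a]\!]_{x_1,\dots,x_m}(u_1,\dots,u_m)=\sum_{i=1}^m P_{x_1,\dots,x_m}(u_1,\dots,u_{i-1},a\cdot_M u_i-u_i\cdot_M a,u_{i+1},\dots,u_m)+P_{x_1,\dots,x_m}(u_1,\dots,u_m)\cdot a-a\cdot P_{x_1,\dots,x_m}(u_1,\dots,u_m)$$ (with $[\![a,P]\!]=-[\![P,a]\!]$); and $[\![a,b]\!]=a\cdot b-b\cdot a$ for $a,b\in A$.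
   Context: $\mathbb K$ is a commutative unital ring with $\mathrm{char}\,\mathbb K\ne 2$; all modules, linear maps, Hom spaces and tensor products are over $\mathbb K$. $X$ is a nonempty set. An associative algebra $A$ is a $\mathbb K$-module with an associative bilinear multiplication $a\cdot b$; an $A$-bimodule $M$ has left and right actions $a\cdot_M u$, $u\cdot_M a$ with $(a\cdot b)\cdot_M u=a\cdot_M(b\cdot_M u)$, $(a\cdot_M u)\cdot_M b=a\cdot_M(u\cdot_M b)$, $(u\cdot_M a)\cdot_M b=u\cdot_M(a\cdot b)$. An element $P\in\mathfrak g^n$ ($n\ge1$) is an arbitrary collection $\{P_{x_1,\dots,x_n}:M^{\otimes n}\to A\}$ of linear maps labelled by $X^{\times n}$ (the symbol $\oplus$ is only notation for such a collection; no finiteness is required), with componentwise addition and scalar multiplication. A graded Lie algebra is a graded $\mathbb K$-module with a degree $0$ bracket that is graded skew-symmetric, $[\![P,Q]\!]=-(-1)^{mn}[\![Q,P]\!]$ for $P,Q$ of degrees $m,n$, and satisfies the graded Jacobi identity. *)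

theory Defs
  imports
    Complex_Main
    "HOL-Library.Poly_Mapping"
    "HOL-Library.Function_Algebras"
    "HOL-Library.Product_Plus"
begin

section \<open>Associative algebras and bimodules over a commutative ring\<close>

text \<open>
  Algebras are not required to have a unit: the class \<open>ring\<close> only provides an associative and
  distributive multiplication.
\<close>

locale associative_algebra = module scale
  for scale :: "'k::comm_ring_1 \<Rightarrow> 'a::ring \<Rightarrow> 'a" +
  assumes mult_scale_left: "scale c a * b = scale c (a * b)"
    and mult_scale_right: "a * scale c b = scale c (a * b)"

locale bimodule = alg: associative_algebra scaleA + vec: module scaleM
  for scaleA :: "'k::comm_ring_1 \<Rightarrow> 'a::ring \<Rightarrow> 'a"
    and scaleM :: "'k \<Rightarrow> 'm::ab_group_add \<Rightarrow> 'm" +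
  fixes lact :: "'a \<Rightarrow> 'm \<Rightarrow> 'm"
    and ract :: "'m \<Rightarrow> 'a \<Rightarrow> 'm"
  assumes lact_linear_left: "module_hom scaleA scaleM (\<lambda>a. lact a u)"
    and lact_linear_right: "module_hom scaleM scaleM (lact a)"
    and ract_linear_left: "module_hom scaleM scaleM (\<lambda>u. ract u a)"
    and ract_linear_right: "module_hom scaleA scaleM (ract u)"
    and lact_assoc: "lact (a * b) u = lact a (lact b u)"
    and lact_ract: "ract (lact a u) b = lact a (ract u b)"
    and ract_assoc: "ract (ract u a) b = ract u (a * b)"


section \<open>Graded Lie algebras\<close>

text \<open>
  The graded module is the internal direct sum, inside the module carried by the ambient type, of
  the submodules \<open>g n\<close>. The values of the bracket outside of this direct sum are irrelevant.
\<close>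

locale graded_lie_algebra = module scale
  for scale :: "'k::comm_ring_1 \<Rightarrow> 'g::ab_group_add \<Rightarrow> 'g" +
  fixes g :: "nat \<Rightarrow> 'g set"
    and bracket :: "'g \<Rightarrow> 'g \<Rightarrow> 'g"
  assumes subspace_component: "subspace (g n)"
    and independent_components:
      "\<lbrakk>finite N; \<And>n. n \<in> N \<Longrightarrow> f n \<in> g n; (\<Sum>n\<in>N. f n) = 0; n \<in> N\<rbrakk> \<Longrightarrow> f n = 0"
    and bracket_add_left:
      "\<lbrakk>x \<in> span (\<Union>n. g n); y \<in> span (\<Union>n. g n); z \<in> span (\<Union>n. g n)\<rbrakk>
        \<Longrightarrow> bracket (x + y) z = bracket x z + bracket y z"
    and bracket_add_right:
      "\<lbrakk>x \<in> span (\<Union>n. g n); y \<in> span (\<Union>n. g n); z \<in> span (\<Union>n. g n)\<rbrakk>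
        \<Longrightarrow> bracket x (y + z) = bracket x y + bracket x z"
    and bracket_scale_left:
      "\<lbrakk>x \<in> span (\<Union>n. g n); y \<in> span (\<Union>n. g n)\<rbrakk>
        \<Longrightarrow> bracket (scale c x) y = scale c (bracket x y)"
    and bracket_scale_right:
      "\<lbrakk>x \<in> span (\<Union>n. g n); y \<in> span (\<Union>n. g n)\<rbrakk>
        \<Longrightarrow> bracket x (scale c y) = scale c (bracket x y)"
    and bracket_degree: "\<lbrakk>x \<in> g m; y \<in> g n\<rbrakk> \<Longrightarrow> bracket x y \<in> g (m + n)"
    and graded_skew_symmetric:
      "\<lbrakk>x \<in> g m; y \<in> g n\<rbrakk> \<Longrightarrow> bracket x y = - scale ((- 1) ^ (m * n)) (bracket y x)"
    and graded_jacobi: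
      "\<lbrakk>x \<in> g m; y \<in> g n; z \<in> g p\<rbrakk>
        \<Longrightarrow> bracket x (bracket y z)
            = bracket (bracket x y) z + scale ((- 1) ^ (m * n)) (bracket y (bracket x z))"


section \<open>Tensor powers of a module\<close>

text \<open>
  The \<open>n\<close>-th tensor power is the quotient of the free module on the lists of length \<open>n\<close> of vectors
  by the submodule generated by the multilinearity relations.
\<close>

definition free_scale :: "'k::comm_ring_1 \<Rightarrow> ('b \<Rightarrow>\<^sub>0 'k) \<Rightarrow> ('b \<Rightarrow>\<^sub>0 'k)"
  where "free_scale c = Poly_Mapping.map ((*) c)"

lemma lookup_free_scale [simp]:
  "Poly_Mapping.lookup (free_scale c p) b = c * Poly_Mapping.lookup p b"
  by (simp add: free_scale_def Poly_Mapping.map.rep_eq when_def)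

interpretation free_module: module free_scale
  by standard (auto intro!: poly_mapping_eqI simp: lookup_add algebra_simps)

definition free_power :: "nat \<Rightarrow> ('m list \<Rightarrow>\<^sub>0 'k::comm_ring_1) set"
  where "free_power n = {p. Poly_Mapping.keys p \<subseteq> {us. length us = n}}"

definition multilinearity_relations ::
    "('k::comm_ring_1 \<Rightarrow> 'm::ab_group_add \<Rightarrow> 'm) \<Rightarrow> nat \<Rightarrow> ('m list \<Rightarrow>\<^sub>0 'k) set"
  where "multilinearity_relations scaleM n =
    {Poly_Mapping.single (us[i := u + v]) 1
       - Poly_Mapping.single (us[i := u]) 1 - Poly_Mapping.single (us[i := v]) 1
      | us i u v. length us = n \<and> i < n}
    \<union> {Poly_Mapping.single (us[i := scaleM c u]) 1
       - free_scale c (Poly_Mapping.single (us[i := u]) 1)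
      | us i c u. length us = n \<and> i < n}"

definition tensor_cong ::
    "('k::comm_ring_1 \<Rightarrow> 'm::ab_group_add \<Rightarrow> 'm) \<Rightarrow> nat
      \<Rightarrow> (('m list \<Rightarrow>\<^sub>0 'k) \<times> ('m list \<Rightarrow>\<^sub>0 'k)) set"
  where "tensor_cong scaleM n =
    {(p, q). p \<in> free_power n \<and> q \<in> free_power n \<and>
       p - q \<in> free_module.span (multilinearity_relations scaleM n)}"

definition tensor_power ::
    "('k::comm_ring_1 \<Rightarrow> 'm::ab_group_add \<Rightarrow> 'm) \<Rightarrow> nat \<Rightarrow> ('m list \<Rightarrow>\<^sub>0 'k) set set"
  where "tensor_power scaleM n = free_power n // tensor_cong scaleM n"

definition tensor_class ::
    "('k::comm_ring_1 \<Rightarrow> 'm::ab_group_add \<Rightarrow> 'm) \<Rightarrow> nat \<Rightarrow> ('m list \<Rightarrow>\<^sub>0 'k)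
      \<Rightarrow> ('m list \<Rightarrow>\<^sub>0 'k) set"
  where "tensor_class scaleM n p = tensor_cong scaleM n `` {p}"

definition pure_tensor ::
    "('k::comm_ring_1 \<Rightarrow> 'm::ab_group_add \<Rightarrow> 'm) \<Rightarrow> 'm list \<Rightarrow> ('m list \<Rightarrow>\<^sub>0 'k) set"
  where "pure_tensor scaleM us = tensor_class scaleM (length us) (Poly_Mapping.single us 1)"

text \<open>
  Linear maps from the \<open>n\<close>-th tensor power to \<open>A\<close>. The sum of the classes of \<open>p\<close> and \<open>q\<close> is the
  class of \<open>p + q\<close>, and similarly for scalar multiples. Maps vanish outside of the tensor power, so
  that they are determined by their restriction to it.
\<close>

definition tensor_hom ::
    "('k::comm_ring_1 \<Rightarrow> 'm::ab_group_add \<Rightarrow> 'm) \<Rightarrow> ('k \<Rightarrow> 'a::ab_group_add \<Rightarrow> 'a) \<Rightarrow> nat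
      \<Rightarrow> (('m list \<Rightarrow>\<^sub>0 'k) set \<Rightarrow> 'a) set"
  where "tensor_hom scaleM scaleA n =
    {h. (\<forall>p \<in> free_power n. \<forall>q \<in> free_power n.
           h (tensor_class scaleM n (p + q))
             = h (tensor_class scaleM n p) + h (tensor_class scaleM n q)) \<and>
        (\<forall>c. \<forall>p \<in> free_power n.
           h (tensor_class scaleM n (free_scale c p)) = scaleA c (h (tensor_class scaleM n p))) \<and>
        (\<forall>t. t \<notin> tensor_power scaleM n \<longrightarrow> h t = 0)}"


text \<open>The universal property: linear maps on the tensor power are the same as multilinear maps.\<close>

lemma subspace_free_power:
  "free_module.subspace (free_power n :: ('m list \<Rightarrow>\<^sub>0 'k::comm_ring_1) set)"
proof -
  have "p + q \<in> free_power n" if "p \<in> free_power n" "q \<in> free_power n" for p q :: "'m list \<Rightarrow>\<^sub>0 'k"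
    using that Poly_Mapping.keys_add[of p q] by (auto simp: free_power_def)
  moreover have "free_scale c p \<in> free_power n" if "p \<in> free_power n" for c and p :: "'m list \<Rightarrow>\<^sub>0 'k"
    using that unfolding free_power_def by (auto simp: in_keys_iff subset_iff) (metis mult_zero_right)
  moreover have "0 \<in> free_power n" by (simp add: free_power_def)
  ultimately show ?thesis by (simp add: free_module.subspace_def)
qed

lemma equiv_tensor_cong: "equiv (free_power n) (tensor_cong scaleM n)"
proof (rule equivI)
  show "refl_on (free_power n) (tensor_cong scaleM n)"
    by (auto simp: refl_on_def tensor_cong_def free_module.span_zero)
  show "tensor_cong scaleM n \<subseteq> free_power n \<times> free_power n"
    by (auto simp: tensor_cong_def)
  show "sym (tensor_cong scaleM n)"
    by (auto simp: sym_def tensor_cong_def dest: free_module.span_neg)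
  show "trans (tensor_cong scaleM n)"
    by (auto simp: trans_def tensor_cong_def dest: free_module.span_add)
qed

lemma tensor_class_eq_iff:
  assumes "p \<in> free_power n" "q \<in> free_power n"
  shows "tensor_class scaleM n p = tensor_class scaleM n q
    \<longleftrightarrow> p - q \<in> free_module.span (multilinearity_relations scaleM n)"
  using eq_equiv_class_iff[OF equiv_tensor_cong assms] assms
  by (simp add: tensor_class_def tensor_cong_def)

lemma tensor_powerE:
  assumes "t \<in> tensor_power scaleM n"
  obtains p where "p \<in> free_power n" "t = tensor_class scaleM n p"
  using assms by (auto simp: tensor_power_def tensor_class_def elim: quotientE)

lemma tensor_class_in_tensor_power:
  "p \<in> free_power n \<Longrightarrow> tensor_class scaleM n p \<in> tensor_power scaleM n"
  by (simp add: tensor_power_def tensor_class_def quotientI)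

lemma free_power_eq_span:
  "(free_power n :: ('m list \<Rightarrow>\<^sub>0 'k::comm_ring_1) set)
    = free_module.span {Poly_Mapping.single us 1 | us. length us = n}" (is "_ = ?S")
proof
  show "?S \<subseteq> free_power n"
    by (rule free_module.span_minimal[OF _ subspace_free_power]) (auto simp: free_power_def)
  have "p \<in> ?S" if "finite K" "Poly_Mapping.keys p \<subseteq> K" "K \<subseteq> {us. length us = n}"
    for K and p :: "'m list \<Rightarrow>\<^sub>0 'k"
    using that
  proof (induction K arbitrary: p rule: finite_induct)
    case empty
    then show ?case by (simp add: free_module.span_zero)
  next
    case (insert us K)
    define q where "q = p - free_scale (Poly_Mapping.lookup p us) (Poly_Mapping.single us 1)"
    have "Poly_Mapping.keys q \<subseteq> K"
    proof
      fix vs assume "vs \<in> Poly_Mapping.keys q"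
      then have ne: "Poly_Mapping.lookup q vs \<noteq> 0" by (simp add: in_keys_iff)
      then have "vs \<noteq> us" by (auto simp: q_def lookup_minus)
      moreover from this ne have "Poly_Mapping.lookup p vs \<noteq> 0"
        by (auto simp: q_def lookup_minus lookup_single when_def)
      ultimately show "vs \<in> K" using insert.prems by (auto simp: in_keys_iff)
    qed
    then have "q \<in> ?S" using insert by simp
    moreover have "free_scale (Poly_Mapping.lookup p us) (Poly_Mapping.single us 1) \<in> ?S"
      using insert.prems by (intro free_module.span_scale free_module.span_base) auto
    ultimately have "q + free_scale (Poly_Mapping.lookup p us) (Poly_Mapping.single us 1) \<in> ?S"
      by (rule free_module.span_add)
    then show ?case by (simp add: q_def)
  qed
  then show "free_power n \<subseteq> ?S"
    using finite_keys unfolding free_power_def by blast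
qed

lemma tensor_hom_universal:
  fixes scaleM :: "'k::comm_ring_1 \<Rightarrow> 'm::ab_group_add \<Rightarrow> 'm"
    and scaleA :: "'k \<Rightarrow> 'a::ab_group_add \<Rightarrow> 'a"
  assumes "module scaleA"
    and add: "\<And>us i u v. \<lbrakk>length us = n; i < n\<rbrakk>
      \<Longrightarrow> f (us[i := u + v]) = f (us[i := u]) + f (us[i := v])"
    and scale: "\<And>us i c u. \<lbrakk>length us = n; i < n\<rbrakk>
      \<Longrightarrow> f (us[i := scaleM c u]) = scaleA c (f (us[i := u]))"
  shows "\<exists>!h. h \<in> tensor_hom scaleM scaleA n \<and>
    (\<forall>us. length us = n \<longrightarrow> h (pure_tensor scaleM us) = f us)"
proof -
  interpret A: module scaleA by fact
  define ext where "ext p = (\<Sum>us\<in>Poly_Mapping.keys p. scaleA (Poly_Mapping.lookup p us) (f us))"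
    for p
  have ext_super: "ext p = (\<Sum>us\<in>K. scaleA (Poly_Mapping.lookup p us) (f us))"
    if "finite K" "Poly_Mapping.keys p \<subseteq> K" for K p
    unfolding ext_def using that by (intro sum.mono_neutral_left) (auto simp: in_keys_iff)
  have ext_add: "ext (p + q) = ext p + ext q" for p q
  proof -
    let ?K = "Poly_Mapping.keys p \<union> Poly_Mapping.keys q"
    have "ext (p + q) = (\<Sum>us\<in>?K. scaleA (Poly_Mapping.lookup (p + q) us) (f us))"
      using Poly_Mapping.keys_add[of p q] by (intro ext_super) auto
    also have "\<dots> = (\<Sum>us\<in>?K. scaleA (Poly_Mapping.lookup p us) (f us))
        + (\<Sum>us\<in>?K. scaleA (Poly_Mapping.lookup q us) (f us))"
      by (simp add: lookup_add A.scale_left_distrib sum.distrib)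
    also have "\<dots> = ext p + ext q"
      using ext_super[of ?K p] ext_super[of ?K q] by simp
    finally show ?thesis .
  qed
  have ext_scale: "ext (free_scale c p) = scaleA c (ext p)" for c p
  proof -
    have "ext (free_scale c p)
        = (\<Sum>us\<in>Poly_Mapping.keys p. scaleA (Poly_Mapping.lookup (free_scale c p) us) (f us))"
      by (intro ext_super) (auto simp: in_keys_iff)
    then show ?thesis by (simp add: ext_def A.scale_sum_right)
  qed
  interpret ext: module_hom free_scale scaleA ext
    by standard (simp_all add: ext_add ext_scale)
  have ext_single: "ext (Poly_Mapping.single us 1) = f us" for us
    by (simp add: ext_def)
  have ext_rel: "ext p = 0" if "p \<in> free_module.span (multilinearity_relations scaleM n)" for p
  proof (rule ext.eq_0_on_span[OF _ that])
    fix q assume "q \<in> multilinearity_relations scaleM n"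
    then show "ext q = 0"
      by (auto simp: multilinearity_relations_def ext.diff ext_scale ext_single add scale)
  qed
  define h where "h t = (if t \<in> tensor_power scaleM n
      then ext (SOME p. p \<in> free_power n \<and> t = tensor_class scaleM n p) else 0)" for t
  have h_class: "h (tensor_class scaleM n p) = ext p" if p: "p \<in> free_power n" for p
  proof -
    define q where "q = (SOME q. q \<in> free_power n \<and> tensor_class scaleM n p = tensor_class scaleM n q)"
    have q: "q \<in> free_power n" "tensor_class scaleM n p = tensor_class scaleM n q"
      using someI[of "\<lambda>q. q \<in> free_power n \<and> tensor_class scaleM n p = tensor_class scaleM n q" p] p
      unfolding q_def by auto
    then have "ext (p - q) = 0"
      using p by (intro ext_rel) (simp add: tensor_class_eq_iff)
    then show ?thesis
      using tensor_class_in_tensor_power[OF p, of scaleM] by (simp add: h_def ext.diff flip: q_def)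
  qed
  have single: "Poly_Mapping.single us 1 \<in> free_power n" if "length us = n" for us :: "'m list"
    using that by (simp add: free_power_def)
  have "h \<in> tensor_hom scaleM scaleA n"
    using subspace_free_power[of n]
    by (auto simp: tensor_hom_def h_class ext_add ext_scale free_module.subspace_def)
      (simp add: h_def)
  moreover have "h (pure_tensor scaleM us) = f us" if "length us = n" for us
    using h_class[OF single[OF that]] that by (simp add: pure_tensor_def ext_single)
  moreover have "h1 = h2"
    if h1: "h1 \<in> tensor_hom scaleM scaleA n" "\<And>us. length us = n \<Longrightarrow> h1 (pure_tensor scaleM us) = f us"
      and h2: "h2 \<in> tensor_hom scaleM scaleA n" "\<And>us. length us = n \<Longrightarrow> h2 (pure_tensor scaleM us) = f us"
    for h1 h2
  proof
    fix t
    show "h1 t = h2 t"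
    proof (cases "t \<in> tensor_power scaleM n")
      case False
      then show ?thesis using h1(1) h2(1) by (simp add: tensor_hom_def)
    next
      case True
      then obtain p where p: "p \<in> free_power n" "t = tensor_class scaleM n p"
        by (rule tensor_powerE)
      let ?E = "{p \<in> free_power n. h1 (tensor_class scaleM n p) = h2 (tensor_class scaleM n p)}"
      have zero: "k (tensor_class scaleM n 0) = 0" if "k \<in> tensor_hom scaleM scaleA n" for k
      proof -
        have "0 \<in> free_power n" by (simp add: free_power_def)
        then have "k (tensor_class scaleM n (0 + 0))
            = k (tensor_class scaleM n 0) + k (tensor_class scaleM n 0)"
          using that unfolding tensor_hom_def by blast
        then show ?thesis by simp
      qed
      have "free_module.subspace ?E"
        using subspace_free_power[of n] h1(1) h2(1)
        by (auto simp: free_module.subspace_def zero) (auto simp: tensor_hom_def)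
      moreover have "{Poly_Mapping.single us 1 | us. length us = n} \<subseteq> ?E"
        using h1(2) h2(2) single by (auto simp: pure_tensor_def)
      ultimately have "free_power n \<subseteq> ?E"
        unfolding free_power_eq_span by (intro free_module.span_minimal) auto
      then show ?thesis using p by blast
    qed
  qed
  ultimately show ?thesis by blast
qed


section \<open>The graded module\<close>

text \<open>
  The ambient module of the grading consists of pairs of an element of \<open>A\<close> (the component of
  degree \<open>0\<close>) and a family of maps labelled by lists over \<open>'x\<close>; the component of degree \<open>n \<ge> 1\<close>
  is the part of that family labelled by the lists of length \<open>n\<close>. The type \<open>'x\<close> is the
  (nonempty) set of labels.
\<close>

type_synonym ('k, 'm, 'a, 'x) labelled_family =
  "'x list \<Rightarrow> ('m list \<Rightarrow>\<^sub>0 'k) set \<Rightarrow> 'a"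

type_synonym ('k, 'm, 'a, 'x) cochain = "'a \<times> ('k, 'm, 'a, 'x) labelled_family"

definition family_space ::
    "('k::comm_ring_1 \<Rightarrow> 'm::ab_group_add \<Rightarrow> 'm) \<Rightarrow> ('k \<Rightarrow> 'a::ab_group_add \<Rightarrow> 'a) \<Rightarrow> nat
      \<Rightarrow> ('k, 'm, 'a, 'x) labelled_family set"
  where "family_space scaleM scaleA n =
    {P. \<forall>xs. if length xs = n then P xs \<in> tensor_hom scaleM scaleA n else P xs = 0}"

definition graded_component ::
    "('k::comm_ring_1 \<Rightarrow> 'm::ab_group_add \<Rightarrow> 'm) \<Rightarrow> ('k \<Rightarrow> 'a::ab_group_add \<Rightarrow> 'a) \<Rightarrow> nat
      \<Rightarrow> ('k, 'm, 'a, 'x) cochain set"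
  where "graded_component scaleM scaleA n =
    (if n = 0 then UNIV \<times> {0} else {0} \<times> family_space scaleM scaleA n)"

definition cochain_scale ::
    "('k \<Rightarrow> 'a \<Rightarrow> 'a) \<Rightarrow> 'k \<Rightarrow> ('k::comm_ring_1, 'm, 'a, 'x) cochain
      \<Rightarrow> ('k, 'm, 'a, 'x) cochain"
  where "cochain_scale scaleA c X = (scaleA c (fst X), \<lambda>xs t. scaleA c (snd X xs t))"

abbreviation deg0 :: "'a \<Rightarrow> ('k::comm_ring_1, 'm, 'a::ab_group_add, 'x) cochain"
  where "deg0 a \<equiv> (a, 0)"

abbreviation fam ::
    "('k::comm_ring_1, 'm, 'a::ab_group_add, 'x) labelled_family \<Rightarrow> ('k, 'm, 'a, 'x) cochain"
  where "fam P \<equiv> (0, P)"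


section \<open>Evaluation and insertion\<close>

text \<open>
  Labels and vectors are given by sequences indexed from \<open>1\<close>; \<open>seg u i j\<close> is the list
  \<open>u i, \<dots>, u j\<close>, which is empty if \<open>j < i\<close>.
\<close>

definition seg :: "(nat \<Rightarrow> 'b) \<Rightarrow> nat \<Rightarrow> nat \<Rightarrow> 'b list"
  where "seg u i j = map u [i..<Suc j]"

definition ev ::
    "('k::comm_ring_1 \<Rightarrow> 'm::ab_group_add \<Rightarrow> 'm) \<Rightarrow> ('k, 'm, 'a, 'x) labelled_family
      \<Rightarrow> 'x list \<Rightarrow> 'm list \<Rightarrow> 'a"
  where "ev scaleM P xs us = P xs (pure_tensor scaleM us)"

end

theory Submission
  imports Defs
begin

text \<open>
  The bracket is a derived bracket. On the functions from words over a module \<open>V\<close> to \<open>V\<close>,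
  Gerstenhaber's circle product inserts one cochain into the slots of another; its associator is a
  sum over the ways to insert two cochains into disjoint slots, hence graded symmetric in the two
  (\<open>circ_associator\<close>), and so its graded commutator satisfies the Jacobi identity. Let
  \<open>V = A \<times> M\<close> with the semidirect product as multiplication \<open>\<pi>\<close>. Associativity of \<open>A\<close> together
  with the bimodule axioms says exactly that \<open>\<pi> \<circ> \<pi> = 0\<close>, so \<open>[\<pi>, -]\<close> is a differential, and it
  follows that \<open>(f, g) \<mapsto> \<plusminus>[[\<pi>, f], g]\<close> satisfies the Jacobi identity in Leibniz
  form with respect to the degree shifted by one (\<open>derived_jacobi\<close>).

  A multilinear map \<open>F\<close> on words over \<open>M\<close> with values in \<open>A\<close> is a cochain on \<open>V\<close> which reads the
  \<open>M\<close>-components of its arguments and has values in \<open>A\<close>. Inserting such a cochain directly into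
  another one gives \<open>0\<close>, and what survives in the derived bracket is that the value of one map is
  multiplied by the letter next to it, or by the value of the other map. This is the bracket of
  the theorem (\<open>lift_bracket\<close>). In that form a single description covers all degrees: in a factorisation
  \<open>w = p q s\<close> the value \<open>G q\<close> acts on the first letter of \<open>s\<close> or on the last letter of \<open>p\<close>; if \<open>s\<close> is
  empty, the action on its first letter is replaced by the product \<open>F p * G q\<close>. Elements of \<open>A\<close> are the
  maps of degree \<open>0\<close>. The graded skew symmetry can be read off from the definition.

  The labels are absorbed into the module: a family of multilinear maps on \<open>M\<close> indexed by words of
  labels is a multilinear map on the direct sum of copies of \<open>M\<close>, one for each label, on which \<open>A\<close>
  acts componentwise. In every term of the bracket the label of a letter stays with that letter,
  also when an element of \<open>A\<close> acts on it, so the Jacobi identity for the direct sum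
  gives the one for families (\<open>labelled_bracket_jacobi\<close>). Finally, by the universal property, families of
  linear maps on tensor powers are the same as multilinear functions of words of labelled vectors.
\<close>

section \<open>Signs, and sums over factorisations of a word\<close>

definition signed :: "bool \<Rightarrow> 'b::ab_group_add \<Rightarrow> 'b"
  where "signed e x = (if e then - x else x)"

lemma signed_simps [simp]: "signed True x = - x" "signed False x = x" "signed e 0 = 0"
  by (simp_all add: signed_def)

lemma signed_add: "signed e (x + y) = signed e x + signed e y"
  by (simp add: signed_def)

lemma signed_diff: "signed e (x - y) = signed e x - signed e y"
  by (simp add: signed_def)

lemma signed_minus: "signed e (- x) = - signed e x"
  by (simp add: signed_def)

lemma signed_sum: "signed e (\<Sum>i\<in>I. f i) = (\<Sum>i\<in>I. signed e (f i))"
  by (simp add: signed_def sum_negf)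

lemma signed_signed: "signed e (signed e' x) = signed (e \<noteq> e') x"
  by (simp add: signed_def)

definition splits :: "'y list \<Rightarrow> ('y list \<times> 'y list \<times> 'y list) set"
  where "splits w = {(p, q, s). p @ q @ s = w}"

definition cuts :: "'y list \<Rightarrow> ('y list \<times> 'y list) set"
  where "cuts w = {(p, s). p @ s = w}"

lemma mem_splits [simp]: "(p, q, s) \<in> splits w \<longleftrightarrow> p @ q @ s = w"
  by (simp add: splits_def)

lemma mem_cuts [simp]: "(p, s) \<in> cuts w \<longleftrightarrow> p @ s = w"
  by (simp add: cuts_def)

lemma sum_eq_single:
  "\<lbrakk>finite A; a \<in> A; \<And>x. x \<in> A \<Longrightarrow> x \<noteq> a \<Longrightarrow> f x = 0\<rbrakk> \<Longrightarrow> sum f A = (f a :: 'b::comm_monoid_add)"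
  by (simp add: sum.remove[of A a f])

lemma finite_cuts [simp]: "finite (cuts w)"
proof -
  have "(p, s) \<in> (\<lambda>k. (take k w, drop k w)) ` {..length w}" if "(p, s) \<in> cuts w" for p s
    using that by (intro image_eqI[of _ _ "length p"]) (auto simp: cuts_def)
  then have "cuts w \<subseteq> (\<lambda>k. (take k w, drop k w)) ` {..length w}" by auto
  then show ?thesis by (rule finite_subset) simp
qed

lemma finite_splits [simp]: "finite (splits w)"
proof -
  have "splits w \<subseteq> (\<lambda>((p, s), (q, s')). (p, q, s')) ` (SIGMA (p, s) : cuts w. cuts s)"
    by (force simp: splits_def cuts_def image_iff)
  then show ?thesis by (rule finite_subset) (auto intro!: finite_imageI)
qed

lemma append_Cons_eq_appendE:
  assumes "a @ x # b = p @ s"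
  obtains t where "a = p @ t" "s = t @ x # b" | t where "p = a @ x # t" "b = t @ s"
proof -
  from assms consider us where "a = p @ us" "us @ x # b = s" | us where "a @ us = p" "x # b = us @ s"
    unfolding append_eq_append_conv2 by blast
  then show thesis
  proof cases
    case 1
    then show ?thesis using that(1) by simp
  next
    case 2
    then show ?thesis using that by (cases us) auto
  qed
qed

text \<open>
  The middle block of a factorisation lies before the marked letter, lies after it, or contains it.
\<close>

lemma sum_splits_Cons_middle:
  fixes F :: "'y list \<Rightarrow> 'y list \<Rightarrow> 'y list \<Rightarrow> 'b::comm_monoid_add"
  shows "(\<Sum>(p, q, s)\<in>splits (a @ x # b). F p q s)
    = (\<Sum>(p, q, s)\<in>splits a. F p q (s @ x # b))
    + (\<Sum>(p, q, s)\<in>splits b. F (a @ x # p) q s)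
    + (\<Sum>(p, q)\<in>cuts a. \<Sum>(r, s)\<in>cuts b. F p (q @ x # r) s)"
proof -
  let ?A = "(\<lambda>(p, q, s). (p, q, s @ x # b)) ` splits a"
  let ?B = "(\<lambda>(p, q, s). (a @ x # p, q, s)) ` splits b"
  let ?C = "(\<lambda>((p, q), (r, s)). (p, q @ x # r, s)) ` (cuts a \<times> cuts b)"
  have eq: "splits (a @ x # b) = ?A \<union> ?B \<union> ?C"
  proof
    show "?A \<union> ?B \<union> ?C \<subseteq> splits (a @ x # b)"
      by (auto simp: splits_def cuts_def)
    show "splits (a @ x # b) \<subseteq> ?A \<union> ?B \<union> ?C"
    proof (rule subsetI, rule ccontr)
      fix z
      assume z: "z \<in> splits (a @ x # b)" and nz: "z \<notin> ?A \<union> ?B \<union> ?C"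
      obtain p q s where pqs: "z = (p, q, s)" by (cases z)
      with nz have nA: "(p, q, s) \<notin> ?A" and nB: "(p, q, s) \<notin> ?B" and nC: "(p, q, s) \<notin> ?C"
        by blast+
      from z pqs have w: "p @ q @ s = a @ x # b" by (simp add: splits_def)
      from w have "a @ x # b = p @ (q @ s)" by simp
      then show False
      proof (cases rule: append_Cons_eq_appendE)
        case (2 t)
        then show ?thesis using nB by (force simp: splits_def)
      next
        case (1 t)
        from 1(2) have "t @ x # b = q @ s" by simp
        then show ?thesis
        proof (cases rule: append_Cons_eq_appendE)
          case (1 t')
          then show ?thesis using nA \<open>a = p @ t\<close> by (force simp: splits_def)
        next
          case (2 t')
          then have "(p, q, s) \<in> ?C" using \<open>a = p @ t\<close>
            by (intro image_eqI[of _ _ "((p, t), (t', s))"]) (auto simp: cuts_def)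
          then show ?thesis using nC by blast
        qed
      qed
    qed
  qed
  have AB: "?A \<inter> ?B = {}" by (auto simp: splits_def)
  have ABC: "(?A \<union> ?B) \<inter> ?C = {}"
  proof -
    have "\<not> (length (fst z) \<le> length a \<and> length (fst z) + length (fst (snd z)) > length a)"
      if "z \<in> ?A \<union> ?B" for z
      using that by (auto simp: splits_def)
    moreover have "length (fst z) \<le> length a \<and> length (fst z) + length (fst (snd z)) > length a"
      if "z \<in> ?C" for z
      using that by (auto simp: cuts_def)
    ultimately show ?thesis by blast
  qed
  have "(\<Sum>(p, q, s)\<in>splits (a @ x # b). F p q s)
     = (\<Sum>(p, q, s)\<in>?A. F p q s) + (\<Sum>(p, q, s)\<in>?B. F p q s) + (\<Sum>(p, q, s)\<in>?C. F p q s)"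
    unfolding eq using AB ABC
    by (subst sum.union_disjoint, simp, simp, blast)+ (rule refl)
  moreover have "(\<Sum>(p, q, s)\<in>?A. F p q s) = (\<Sum>(p, q, s)\<in>splits a. F p q (s @ x # b))"
    by (subst sum.reindex) (auto simp: inj_on_def intro!: sum.cong)
  moreover have "(\<Sum>(p, q, s)\<in>?B. F p q s) = (\<Sum>(p, q, s)\<in>splits b. F (a @ x # p) q s)"
    by (subst sum.reindex) (auto simp: inj_on_def intro!: sum.cong)
  moreover have "(\<Sum>(p, q, s)\<in>?C. F p q s)
      = (\<Sum>(p, q)\<in>cuts a. \<Sum>(r, s)\<in>cuts b. F p (q @ x # r) s)"
  proof -
    have "inj_on (\<lambda>((p, q), (r, s)). (p, q @ x # r, s)) (cuts a \<times> cuts b)"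
      by (auto simp: inj_on_def cuts_def)
    then show ?thesis
      by (subst sum.reindex) (auto simp: sum.cartesian_product split_def intro!: sum.cong)
  qed
  ultimately show ?thesis by simp
qed

text \<open>
  Double insertions into disjoint blocks are thus listed from the left, whichever insertion comes first.
\<close>

lemma sum_splits_disjoint:
  fixes G :: "'y list \<Rightarrow> 'y list \<Rightarrow> 'y list \<Rightarrow> 'y list \<Rightarrow> 'y list \<Rightarrow> 'b::comm_monoid_add"
  shows "(\<Sum>(p, r, s)\<in>splits w. \<Sum>(p', q, t)\<in>splits p. G p' q t r s)
    = (\<Sum>(p', q, s')\<in>splits w. \<Sum>(t, r, s)\<in>splits s'. G p' q t r s)"
proof -
  have "(\<Sum>(p, r, s)\<in>splits w. \<Sum>(p', q, t)\<in>splits p. G p' q t r s)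
    = (\<Sum>((p, r, s), (p', q, t))\<in>(SIGMA (p, r, s) : splits w. splits p). G p' q t r s)"
    by (subst sum.Sigma[symmetric]) (auto intro!: sum.cong)
  also have "\<dots> = (\<Sum>((p', q, s'), (t, r, s))\<in>(SIGMA (p', q, s') : splits w. splits s'). G p' q t r s)"
    by (rule sum.reindex_bij_witness[where
          i = "\<lambda>((p', q, s'), (t, r, s)). ((p' @ q @ t, r, s), (p', q, t))" and
          j = "\<lambda>((p, r, s), (p', q, t)). ((p', q, t @ r @ s), (t, r, s))"])
      (auto simp: splits_def)
  also have "\<dots> = (\<Sum>(p', q, s')\<in>splits w. \<Sum>(t, r, s)\<in>splits s'. G p' q t r s)"
    by (subst sum.Sigma[symmetric]) (auto intro!: sum.cong)
  finally show ?thesis .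
qed

text \<open>
  This identifies the terms of a double insertion in which the second value is an argument of the
  first with an insertion of an insertion.
\<close>

lemma sum_splits_nested:
  fixes G :: "'y list \<Rightarrow> 'y list \<Rightarrow> 'y list \<Rightarrow> 'y list \<Rightarrow> 'y list \<Rightarrow> 'b::comm_monoid_add"
  shows "(\<Sum>(p, r, s)\<in>splits w. \<Sum>(p', q)\<in>cuts p. \<Sum>(q', s')\<in>cuts s. G p' q r q' s')
    = (\<Sum>(p', q0, s')\<in>splits w. \<Sum>(q, r, q')\<in>splits q0. G p' q r q' s')"
proof -
  have "(\<Sum>(p, r, s)\<in>splits w. \<Sum>(p', q)\<in>cuts p. \<Sum>(q', s')\<in>cuts s. G p' q r q' s')
    = (\<Sum>((p, r, s), (p', q), (q', s'))\<in>(SIGMA (p, r, s) : splits w. cuts p \<times> cuts s). G p' q r q' s')"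
    by (subst sum.Sigma[symmetric]) (auto simp: sum.cartesian_product split_def intro!: sum.cong)
  also have "\<dots> = (\<Sum>((p', q0, s'), (q, r, q'))\<in>(SIGMA (p', q0, s') : splits w. splits q0). G p' q r q' s')"
    by (rule sum.reindex_bij_witness[where
          i = "\<lambda>((p', q0, s'), (q, r, q')). ((p' @ q, r, q' @ s'), (p', q), (q', s'))" and
          j = "\<lambda>((p, r, s), (p', q), (q', s')). ((p', q @ r @ q', s'), (q, r, q'))"])
      (auto simp: splits_def cuts_def)
  also have "\<dots> = (\<Sum>(p', q0, s')\<in>splits w. \<Sum>(q, r, q')\<in>splits q0. G p' q r q' s')"
    by (subst sum.Sigma[symmetric]) (auto intro!: sum.cong)
  finally show ?thesis .
qed

lemma sum_triple_cong:
  assumes "\<And>p q s. (p, q, s) \<in> A \<Longrightarrow> f p q s = g p q s"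
  shows "(\<Sum>(p, q, s)\<in>A. f p q s) = (\<Sum>(p, q, s)\<in>A. g p q s)"
  using assms by (auto intro!: sum.cong)

lemma sum_pair_cong:
  assumes "\<And>p s. (p, s) \<in> A \<Longrightarrow> f p s = g p s"
  shows "(\<Sum>(p, s)\<in>A. f p s) = (\<Sum>(p, s)\<in>A. g p s)"
  using assms by (auto intro!: sum.cong)

lemma sum_splits_empty_right:
  fixes f :: "'y list \<Rightarrow> 'y list \<Rightarrow> 'b::comm_monoid_add"
  shows "(\<Sum>(p, q, s)\<in>splits w. if s = [] then f p q else 0) = (\<Sum>(p, q)\<in>cuts w. f p q)"
proof -
  have "(\<Sum>(p, q, s)\<in>splits w. if s = [] then f p q else 0)
      = (\<Sum>(p, q, s)\<in>(\<lambda>(p, q). (p, q, [] :: 'y list)) ` cuts w. if s = [] then f p q else 0)"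
    by (rule sum.mono_neutral_right) (force split: if_splits)+
  also have "\<dots> = (\<Sum>(p, q)\<in>cuts w. f p q)"
    by (subst sum.reindex) (auto simp: inj_on_def split_def)
  finally show ?thesis .
qed

lemma sum_splits_empty_left:
  fixes f :: "'y list \<Rightarrow> 'y list \<Rightarrow> 'b::comm_monoid_add"
  shows "(\<Sum>(p, q, s)\<in>splits w. if p = [] then f q s else 0) = (\<Sum>(q, s)\<in>cuts w. f q s)"
proof -
  have "(\<Sum>(p, q, s)\<in>splits w. if p = [] then f q s else 0)
      = (\<Sum>(p, q, s)\<in>(\<lambda>(q, s). ([] :: 'y list, q, s)) ` cuts w. if p = [] then f q s else 0)"
    by (rule sum.mono_neutral_right) (force split: if_splits)+
  also have "\<dots> = (\<Sum>(p, q)\<in>cuts w. f p q)"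
    by (subst sum.reindex) (auto simp: inj_on_def split_def)
  finally show ?thesis .
qed

lemma sum_splits_all_but_last:
  fixes f :: "'y list \<Rightarrow> 'y \<Rightarrow> 'b::comm_monoid_add"
  shows "(\<Sum>(p, q, s)\<in>splits w. if p = [] \<and> length s = 1 then f q (hd s) else 0)
    = (if w = [] then 0 else f (butlast w) (last w))"
proof (cases "w = []")
  case True
  then show ?thesis by (auto intro!: sum.neutral)
next
  case False
  then show ?thesis
    by (subst sum_eq_single[where a = "([], butlast w, [last w])"])
      (auto simp: length_Suc_conv split: if_splits)
qed

lemma sum_splits_all_but_first:
  fixes f :: "'y \<Rightarrow> 'y list \<Rightarrow> 'b::comm_monoid_add"
  shows "(\<Sum>(p, q, s)\<in>splits w. if length p = 1 \<and> s = [] then f (hd p) q else 0)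
    = (if w = [] then 0 else f (hd w) (tl w))"
proof (cases "w = []")
  case True
  then show ?thesis by (auto intro!: sum.neutral)
next
  case False
  then show ?thesis
    by (subst sum_eq_single[where a = "([hd w], tl w, [])"])
      (auto simp: length_Suc_conv split: if_splits)
qed

lemma sum_cuts_empty_left:
  fixes f :: "'y list \<Rightarrow> 'b::comm_monoid_add"
  shows "(\<Sum>(p, s)\<in>cuts w. if p = [] then f s else 0) = f w"
  by (subst sum_eq_single[where a = "([], w)"]) (auto split: if_splits)

lemma sum_cuts_empty_right:
  fixes f :: "'y list \<Rightarrow> 'b::comm_monoid_add"
  shows "(\<Sum>(p, s)\<in>cuts w. if s = [] then f p else 0) = f w"
  by (subst sum_eq_single[where a = "(w, [])"]) (auto split: if_splits)

lemma sum_cuts_first: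
  fixes f :: "'y \<Rightarrow> 'y list \<Rightarrow> 'b::comm_monoid_add"
  shows "(\<Sum>(p, s)\<in>cuts w. if length p = 1 then f (hd p) s else 0)
    = (if w = [] then 0 else f (hd w) (tl w))"
proof (cases "w = []")
  case True
  then show ?thesis by (auto intro!: sum.neutral)
next
  case False
  then show ?thesis
    by (subst sum_eq_single[where a = "([hd w], tl w)"]) (auto simp: length_Suc_conv split: if_splits)
qed

lemma sum_cuts_last:
  fixes f :: "'y list \<Rightarrow> 'y \<Rightarrow> 'b::comm_monoid_add"
  shows "(\<Sum>(p, s)\<in>cuts w. if length s = 1 then f p (hd s) else 0)
    = (if w = [] then 0 else f (butlast w) (last w))"
proof (cases "w = []")
  case True
  then show ?thesis by (auto intro!: sum.neutral)
next
  case False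
  then show ?thesis
    by (subst sum_eq_single[where a = "(butlast w, [last w])"]) (auto simp: length_Suc_conv split: if_splits)
qed

lemma sum_splits_map:
  "(\<Sum>(p, q, s)\<in>splits (map h w). f p q s) = (\<Sum>(p, q, s)\<in>splits w. f (map h p) (map h q) (map h s))"
proof -
  let ?h = "\<lambda>(p, q, s). (map h p, map h q, map h s)"
  have "splits (map h w) = ?h ` splits w"
  proof
    show "splits (map h w) \<subseteq> ?h ` splits w"
    proof clarify
      fix p q s assume "(p, q, s) \<in> splits (map h w)"
      then obtain p' q' s' where "w = p' @ q' @ s'" "p = map h p'" "q = map h q'" "s = map h s'"
        by (auto simp: append_eq_map_conv)
      then show "(p, q, s) \<in> ?h ` splits w"
        by (intro image_eqI[of _ _ "(p', q', s')"]) auto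
    qed
  qed auto
  moreover have "inj_on ?h (splits w)"
    by (auto simp: inj_on_def splits_def) (metis append_eq_append_conv length_map)+
  ultimately show ?thesis
    by (simp add: sum.reindex split_def)
qed

text \<open>
  Moving the last letter of the middle block to the right block matches the factorisations with
  nonempty middle block with those with nonempty right block. This trades a product of a value with
  the letter after it for an action of the value on that letter.
\<close>

lemma sum_splits_move_last:
  fixes f :: "'y list \<Rightarrow> 'y list \<Rightarrow> 'y \<Rightarrow> 'y list \<Rightarrow> 'b::comm_monoid_add"
  shows "(\<Sum>(p, q, s)\<in>splits w. if q = [] then 0 else f p (butlast q) (last q) s)
    = (\<Sum>(p, q, s)\<in>splits w. if s = [] then 0 else f p q (hd s) (tl s))"
proof -
  have "(\<Sum>(p, q, s)\<in>splits w. if q = [] then 0 else f p (butlast q) (last q) s)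
      = (\<Sum>(p, q, s)\<in>{(p, q, s) \<in> splits w. q \<noteq> []}. f p (butlast q) (last q) s)"
    by (rule sum.mono_neutral_cong_right) auto
  also have "\<dots> = (\<Sum>(p, q, s)\<in>{(p, q, s) \<in> splits w. s \<noteq> []}. f p q (hd s) (tl s))"
    by (rule sum.reindex_bij_witness[where
          j = "\<lambda>(p, q, s). (p, butlast q, last q # s)" and i = "\<lambda>(p, q, s). (p, q @ [hd s], tl s)"]) auto
  also have "\<dots> = (\<Sum>(p, q, s)\<in>splits w. if s = [] then 0 else f p q (hd s) (tl s))"
    by (rule sum.mono_neutral_cong_left) auto
  finally show ?thesis .
qed

lemma sum_splits_move_first:
  fixes f :: "'y list \<Rightarrow> 'y \<Rightarrow> 'y list \<Rightarrow> 'y list \<Rightarrow> 'b::comm_monoid_add"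
  shows "(\<Sum>(p, q, s)\<in>splits w. if q = [] then 0 else f p (hd q) (tl q) s)
    = (\<Sum>(p, q, s)\<in>splits w. if p = [] then 0 else f (butlast p) (last p) q s)"
proof -
  have "(\<Sum>(p, q, s)\<in>splits w. if q = [] then 0 else f p (hd q) (tl q) s)
      = (\<Sum>(p, q, s)\<in>{(p, q, s) \<in> splits w. q \<noteq> []}. f p (hd q) (tl q) s)"
    by (rule sum.mono_neutral_cong_right) auto
  also have "\<dots> = (\<Sum>(p, q, s)\<in>{(p, q, s) \<in> splits w. p \<noteq> []}. f (butlast p) (last p) q s)"
    by (rule sum.reindex_bij_witness[where
          j = "\<lambda>(p, q, s). (p @ [hd q], tl q, s)" and i = "\<lambda>(p, q, s). (butlast p, last p # q, s)"]) auto
  also have "\<dots> = (\<Sum>(p, q, s)\<in>splits w. if p = [] then 0 else f (butlast p) (last p) q s)"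
    by (rule sum.mono_neutral_cong_left) auto
  finally show ?thesis .
qed

lemma sum_Pair_zero: "(\<Sum>x\<in>A. (f x, 0)) = (\<Sum>x\<in>A. f x, 0 :: 'b::comm_monoid_add)"
  by (simp add: prod_eq_iff fst_sum snd_sum)

section \<open>Multilinear maps on words\<close>

text \<open>
  The letters need not form a module: \<open>comb c u v w\<close> says that \<open>w\<close> is the combination \<open>c u + v\<close>. For
  labelled vectors it holds only between vectors with the same label, so the notion covers both the maps on
  words over a module and the families of maps on words of labelled vectors.
\<close>

definition multilinear :: "('k \<Rightarrow> 'y \<Rightarrow> 'y \<Rightarrow> 'y \<Rightarrow> bool) \<Rightarrow> ('k \<Rightarrow> 'b \<Rightarrow> 'b)
    \<Rightarrow> ('y list \<Rightarrow> 'b::ab_group_add) \<Rightarrow> bool"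
  where "multilinear comb scale F \<longleftrightarrow> (\<forall>p s c u v w. comb c u v w
    \<longrightarrow> F (p @ w # s) = scale c (F (p @ u # s)) + F (p @ v # s))"

lemma multilinearD:
  "multilinear comb scale F \<Longrightarrow> comb c u v w
    \<Longrightarrow> F (p @ w # s) = scale c (F (p @ u # s)) + F (p @ v # s)"
  unfolding multilinear_def by blast

definition lincomb :: "('k \<Rightarrow> 'm \<Rightarrow> 'm) \<Rightarrow> 'k \<Rightarrow> 'm \<Rightarrow> 'm \<Rightarrow> 'm::ab_group_add \<Rightarrow> bool"
  where "lincomb scale c u v w \<longleftrightarrow> w = scale c u + v"

context module
begin

lemma scale_signed: "scale c (signed e x) = signed e (scale c x)"
  by (simp add: signed_def)

end

locale multilinear_map = source: module scaleM + target: module scaleB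
  for scaleM :: "'k::comm_ring_1 \<Rightarrow> 'm::ab_group_add \<Rightarrow> 'm"
    and scaleB :: "'k \<Rightarrow> 'b::ab_group_add \<Rightarrow> 'b" +
  fixes F :: "'m list \<Rightarrow> 'b"
  assumes multilinear: "multilinear (lincomb scaleM) scaleB F"
begin

lemma slot_add: "F (p @ (u + v) # s) = F (p @ u # s) + F (p @ v # s)"
  using multilinearD[OF multilinear, of 1 u v "u + v" p s] by (simp add: lincomb_def)

lemma slot_zero [simp]: "F (p @ 0 # s) = 0"
  using slot_add[of p 0 0 s] by simp

lemma slot_scale: "F (p @ scaleM c u # s) = scaleB c (F (p @ u # s))"
  using multilinearD[OF multilinear, of c u 0 "scaleM c u" p s] by (simp add: lincomb_def)

lemma slot_minus: "F (p @ (- u) # s) = - F (p @ u # s)"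
  using slot_add[of p u "- u" s] by (simp add: eq_neg_iff_add_eq_0 add.commute)

lemma slot_diff: "F (p @ (u - v) # s) = F (p @ u # s) - F (p @ v # s)"
  using slot_add[of p u "- v" s] by (simp add: slot_minus)

lemma slot_signed: "F (p @ signed e u # s) = signed e (F (p @ u # s))"
  by (simp add: signed_def slot_minus)

lemma slot_sum: "F (p @ (\<Sum>i\<in>I. g i) # s) = (\<Sum>i\<in>I. F (p @ g i # s))"
  by (induction I rule: infinite_finite_induct) (simp_all add: slot_add)

end

section \<open>The Gerstenhaber circle product\<close>

text \<open>
  With a cochain on \<open>n\<close> letters in degree \<open>n - 1\<close>, this is the graded insertion product: \<open>g\<close> passes the
  letters of \<open>p\<close>, which have degree \<open>1\<close>. The degree of \<open>g\<close> is read off from the length of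
  \<open>q\<close>, so that no degrees have to be passed as arguments.
\<close>

definition circ :: "('v list \<Rightarrow> 'b) \<Rightarrow> ('v list \<Rightarrow> 'v) \<Rightarrow> 'v list \<Rightarrow> 'b::ab_group_add"
  where "circ f g w = (\<Sum>(p, q, s)\<in>splits w.
    signed (odd (length p * (length q + 1))) (f (p @ g q # s)))"

text \<open>
  The first inserted value counts as one letter for the sign of the second insertion.
\<close>

definition circ_disjoint ::
    "('v list \<Rightarrow> 'b) \<Rightarrow> ('v list \<Rightarrow> 'v) \<Rightarrow> ('v list \<Rightarrow> 'v) \<Rightarrow> 'v list \<Rightarrow> 'b::ab_group_add"
  where "circ_disjoint f g h w = (\<Sum>(p, q, s)\<in>splits w. \<Sum>(t, r, s')\<in>splits s.
    signed (odd (length p * (length q + 1)) \<noteq> odd ((length p + length t + 1) * (length r + 1)))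
      (f (p @ g q # t @ h r # s')))"

text \<open>
  The parity \<open>e\<close> is that of the shifted degree \<open>length w - 1\<close>: an even number of letters means odd degree.
\<close>

definition homogeneous :: "bool \<Rightarrow> ('v list \<Rightarrow> 'b::zero) \<Rightarrow> bool"
  where "homogeneous e f \<longleftrightarrow> (\<forall>w. f w \<noteq> 0 \<longrightarrow> even (length w) = e)"

lemma circ_add_left: "circ (f + f') g = circ f g + circ f' g"
  by (rule ext) (simp add: circ_def signed_add split_def sum.distrib)

lemma circ_minus_left: "circ (- f) g = - circ f g"
  by (rule ext) (simp add: circ_def signed_minus split_def sum_negf)

text \<open>
  In \<open>circ (circ f g) h\<close> the value of \<open>h\<close> is fed to \<open>g\<close>, or goes into a slot of \<open>f\<close> to the right or to the
  left of the value of \<open>g\<close>. The first case is \<open>circ f (circ g h)\<close>.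
\<close>

lemma circ_associator:
  fixes f g h :: "'m::ab_group_add list \<Rightarrow> 'm"
  assumes "multilinear_map scaleM scaleM f"
    and g: "homogeneous eg g" and h: "homogeneous eh h"
  shows "circ (circ f g) h = circ f (circ g h) + (circ_disjoint f h g + signed (eg \<and> eh) (circ_disjoint f g h))"
proof
  fix w
  interpret f: multilinear_map scaleM scaleM f by fact
  let ?s = "\<lambda>p q. odd (length p * (length q + 1))"
  have "circ (circ f g) h w = (\<Sum>(p, r, s)\<in>splits w. signed (?s p r) (circ f g (p @ h r # s)))"
    by (simp add: circ_def)
  also have "\<dots> = (\<Sum>(p, r, s)\<in>splits w.
      (\<Sum>(p', q, t)\<in>splits p. signed (?s p r) (signed (?s p' q) (f (p' @ g q # t @ h r # s))))
    + (\<Sum>(t, q, s')\<in>splits s. signed (?s p r) (signed (?s (p @ h r # t) q) (f (p @ h r # t @ g q # s'))))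
    + (\<Sum>(p', q)\<in>cuts p. \<Sum>(q', s')\<in>cuts s.
        signed (?s p r) (signed (?s p' (q @ h r # q')) (f (p' @ g (q @ h r # q') # s')))))"
    unfolding circ_def sum_splits_Cons_middle
    by (simp add: signed_add signed_sum split_def)
  also have "\<dots> =
      (\<Sum>(p, r, s)\<in>splits w. \<Sum>(p', q, t)\<in>splits p.
        signed (?s p r) (signed (?s p' q) (f (p' @ g q # t @ h r # s))))
    + circ_disjoint f h g w
    + (\<Sum>(p, r, s)\<in>splits w. \<Sum>(p', q)\<in>cuts p. \<Sum>(q', s')\<in>cuts s.
        signed (?s p r) (signed (?s p' (q @ h r # q')) (f (p' @ g (q @ h r # q') # s'))))"
    by (simp add: circ_disjoint_def sum.distrib split_def signed_signed add.assoc)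
  also have "(\<Sum>(p, r, s)\<in>splits w. \<Sum>(p', q, t)\<in>splits p.
        signed (?s p r) (signed (?s p' q) (f (p' @ g q # t @ h r # s))))
    = signed (eg \<and> eh) (circ_disjoint f g h w)"
  proof -
    have "(\<Sum>(p, r, s)\<in>splits w. \<Sum>(p', q, t)\<in>splits p.
        signed (?s p r) (signed (?s p' q) (f (p' @ g q # t @ h r # s))))
      = (\<Sum>(p, r, s)\<in>splits w. \<Sum>(p', q, t)\<in>splits p.
        signed (?s (p' @ q @ t) r) (signed (?s p' q) (f (p' @ g q # t @ h r # s))))"
      by (intro sum_triple_cong) (simp add: splits_def)
    also have "\<dots> = (\<Sum>(p', q, s')\<in>splits w. \<Sum>(t, r, s)\<in>splits s'.
        signed (?s (p' @ q @ t) r) (signed (?s p' q) (f (p' @ g q # t @ h r # s))))"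
      by (rule sum_splits_disjoint)
    also have "\<dots> = signed (eg \<and> eh) (circ_disjoint f g h w)"
      unfolding circ_disjoint_def split_def signed_sum
    proof (intro sum.cong refl)
      fix x y :: "'m list \<times> 'm list \<times> 'm list"
      obtain p q s' t r s where [simp]: "x = (p, q, s')" "y = (t, r, s)" by (cases x, cases y)
      show "signed (?s (fst x @ fst (snd x) @ fst y) (fst (snd y)))
          (signed (?s (fst x) (fst (snd x)))
            (f (fst x @ g (fst (snd x)) # fst y @ h (fst (snd y)) # snd (snd y))))
        = signed (eg \<and> eh) (signed (?s (fst x) (fst (snd x))
            \<noteq> odd ((length (fst x) + length (fst y) + 1) * (length (fst (snd y)) + 1)))
            (f (fst x @ g (fst (snd x)) # fst y @ h (fst (snd y)) # snd (snd y))))"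
        \<comment> \<open>A value enters the other sign through the length of its word, whose parity is known only
          if the value does not vanish; a term with a vanishing value is zero.\<close>
      proof (cases "g q = 0 \<or> h r = 0")
        case True
        then show ?thesis using f.slot_zero[of "p @ g q # t" s] by auto
      next
        case False
        then have "eg = even (length q)" "eh = even (length r)"
          using g h by (auto simp: homogeneous_def)
        then show ?thesis
          by (auto simp: signed_signed signed_def)
      qed
    qed
    finally show ?thesis .
  qed
  also have "(\<Sum>(p, r, s)\<in>splits w. \<Sum>(p', q)\<in>cuts p. \<Sum>(q', s')\<in>cuts s.
        signed (?s p r) (signed (?s p' (q @ h r # q')) (f (p' @ g (q @ h r # q') # s'))))
      = circ f (circ g h) w"
  proof -
    have "(\<Sum>(p, r, s)\<in>splits w. \<Sum>(p', q)\<in>cuts p. \<Sum>(q', s')\<in>cuts s.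
        signed (?s p r) (signed (?s p' (q @ h r # q')) (f (p' @ g (q @ h r # q') # s'))))
      = (\<Sum>(p, r, s)\<in>splits w. \<Sum>(p', q)\<in>cuts p. \<Sum>(q', s')\<in>cuts s.
        signed (?s p' (q @ r @ q')) (signed (?s q r) (f (p' @ g (q @ h r # q') # s'))))"
      by (intro sum_triple_cong sum_pair_cong) (auto simp: cuts_def signed_signed signed_def)
    also have "\<dots> = (\<Sum>(p, q, s)\<in>splits w. \<Sum>(q1, r, q2)\<in>splits q.
        signed (?s p (q1 @ r @ q2)) (signed (?s q1 r) (f (p @ g (q1 @ h r # q2) # s))))"
      by (rule sum_splits_nested)
    also have "\<dots> = circ f (circ g h) w"
      unfolding circ_def
      by (intro sum_triple_cong)
        (auto simp: f.slot_sum f.slot_signed signed_sum split_def splits_def intro!: sum.cong)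
    finally show ?thesis .
  qed
  finally show "circ (circ f g) h w
      = (circ f (circ g h) + (circ_disjoint f h g + signed (eg \<and> eh) (circ_disjoint f g h))) w"
    by (simp add: signed_def)
qed

lemma circ_pre_lie:
  fixes f g h :: "'m::ab_group_add list \<Rightarrow> 'm"
  assumes "multilinear_map scaleM scaleM f" "homogeneous eg g" "homogeneous eh h"
  shows "circ (circ f g) h - circ f (circ g h)
    = signed (eg \<and> eh) (circ (circ f h) g - circ f (circ h g))"
  unfolding circ_associator[OF assms] circ_associator[OF assms(1,3,2)]
  by (auto simp: signed_def)

text \<open>
  Graded symmetry only yields that twice the associator vanishes here; the explicit form of the
  associator gives the statement over every ring, as its two parts cancel.
\<close>

lemma circ_circ_odd:
  fixes f g :: "'m::ab_group_add list \<Rightarrow> 'm"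
  assumes "multilinear_map scaleM scaleM f" "homogeneous True g"
  shows "circ (circ f g) g = circ f (circ g g)"
  using circ_associator[OF assms assms(2)] by simp

lemma (in module) multilinear_circ:
  assumes f: "multilinear_map scale scale f" and g: "multilinear_map scale scale g"
  shows "multilinear_map scale scale (circ f g)"
proof -
  interpret f: multilinear_map scale scale f by fact
  interpret g: multilinear_map scale scale g by fact
  have "circ f g (a @ (scale c u + v) # b) = scale c (circ f g (a @ u # b)) + circ f g (a @ v # b)"
    for a b c u v
  proof -
    have 1: "f (p @ g q # t @ (scale c u + v) # b) = 
      scale c (f (p @ g q # t @ u # b)) + f (p @ g q # t @ v # b)" for p q t
      using f.slot_add[of "p @ g q # t" "scale c u" v b] f.slot_scale[of "p @ g q # t" c u b] by simp
    show ?thesis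
      unfolding circ_def sum_splits_Cons_middle
      by (simp add: 1 f.slot_add f.slot_scale g.slot_add g.slot_scale scale_signed signed_add
          sum.distrib scale_sum_right split_def scale_right_distrib)
  qed
  then have "multilinear (lincomb scale) scale (circ f g)"
    by (auto simp: multilinear_def lincomb_def)
  then show ?thesis by unfold_locales
qed

lemma circ_add_right:
  assumes "multilinear_map scale scale' f"
  shows "circ f (g + h) = circ f g + circ f h"
proof -
  interpret multilinear_map scale scale' f by fact
  show ?thesis by (rule ext) (simp add: circ_def slot_add signed_add sum.distrib split_def)
qed

lemma circ_minus_right:
  assumes "multilinear_map scale scale' f"
  shows "circ f (- g) = - circ f g"
proof -
  interpret multilinear_map scale scale' f by fact
  show ?thesis by (rule ext) (simp add: circ_def slot_minus signed_minus sum_negf split_def)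
qed

lemma homogeneous_circ:
  assumes "multilinear_map scale scale' f" "homogeneous ef f" "homogeneous eg g"
  shows "homogeneous (ef \<noteq> eg) (circ f g)"
  unfolding homogeneous_def
proof (intro allI impI)
  interpret multilinear_map scale scale' f by fact
  fix w assume "circ f g w \<noteq> 0"
  then obtain p q s where "(p, q, s) \<in> splits w" "f (p @ g q # s) \<noteq> 0"
    unfolding circ_def by (elim sum.not_neutral_contains_not_neutral) (auto simp: signed_def split: if_splits)
  moreover from this have "g q \<noteq> 0" by (metis slot_zero)
  ultimately show "even (length w) = (ef \<noteq> eg)"
    using assms(2,3) by (fastforce simp: homogeneous_def splits_def)
qed

section \<open>Graded pre-Lie algebras and derived brackets\<close>

text \<open>
  Only the parity of the degrees enters the signs, so the grading is by \<open>bool\<close>, with \<open>True\<close> for odd.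
\<close>

locale graded_pre_lie =
  fixes H :: "bool \<Rightarrow> 'g::ab_group_add set" and prod :: "'g \<Rightarrow> 'g \<Rightarrow> 'g"
  assumes H_add: "f \<in> H e \<Longrightarrow> g \<in> H e \<Longrightarrow> f + g \<in> H e"
    and H_minus: "f \<in> H e \<Longrightarrow> - f \<in> H e"
    and H_prod: "f \<in> H e \<Longrightarrow> g \<in> H e' \<Longrightarrow> prod f g \<in> H (e \<noteq> e')"
    and prod_add_left: "prod (f + f') g = prod f g + prod f' g"
    and prod_minus_left: "prod (- f) g = - prod f g"
    and prod_add_right: "f \<in> H e \<Longrightarrow> prod f (g + g') = prod f g + prod f g'"
    and prod_minus_right: "f \<in> H e \<Longrightarrow> prod f (- g) = - prod f g"
    and pre_lie: "\<lbrakk>f \<in> H e; g \<in> H eg; h \<in> H eh\<rbrakk> \<Longrightarrow> prod (prod f g) h - prod f (prod g h)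
      = signed (eg \<and> eh) (prod (prod f h) g - prod f (prod h g))"
begin

definition commutator :: "bool \<Rightarrow> bool \<Rightarrow> 'g \<Rightarrow> 'g \<Rightarrow> 'g"
  where "commutator e e' f g = prod f g - signed (e \<and> e') (prod g f)"

lemma commutator_minus_right: "f \<in> H e0 \<Longrightarrow> commutator e e' f (- g) = - commutator e e' f g"
  by (simp add: commutator_def prod_minus_right prod_minus_left signed_minus)

lemma commutator_minus_left: "g \<in> H e0 \<Longrightarrow> commutator e e' (- f) g = - commutator e e' f g"
  by (simp add: commutator_def prod_minus_right prod_minus_left signed_minus)

lemma prod_diff_left: "prod (f - f') g = prod f g - prod f' g"
  using prod_add_left[of f "- f'" g] by (simp add: prod_minus_left)

lemma prod_diff_right: "f \<in> H e \<Longrightarrow> prod f (g - g') = prod f g - prod f g'"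
  using prod_add_right[of f e g "- g'"] by (simp add: prod_minus_right)

lemma H_diff: "f \<in> H e \<Longrightarrow> g \<in> H e \<Longrightarrow> f - g \<in> H e"
  unfolding diff_conv_add_uminus by (intro H_add H_minus)

lemma H_commutator: "f \<in> H e \<Longrightarrow> g \<in> H e' \<Longrightarrow> commutator e e' f g \<in> H (e \<noteq> e')"
  unfolding commutator_def
  using H_prod[of f e g e'] H_prod[of g e' f e]
  by (cases e; cases e') (auto simp: signed_def intro: H_add H_diff)

text \<open>
  The defect of the identity is a signed sum of associators over the six orders of the arguments, and
  these cancel in pairs by the pre-Lie identity.
\<close>

lemma commutator_jacobi:
  assumes f: "f \<in> H ef" and g: "g \<in> H eg" and h: "h \<in> H eh"
  shows "commutator ef (eg \<noteq> eh) f (commutator eg eh g h)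
    = commutator (ef \<noteq> eg) eh (commutator ef eg f g) h
      + signed (ef \<and> eg) (commutator eg (ef \<noteq> eh) g (commutator ef eh f h))"
proof -
  note R = prod_add_left prod_minus_left prod_add_right[OF f] prod_add_right[OF g] prod_add_right[OF h]
    prod_minus_right[OF f] prod_minus_right[OF g] prod_minus_right[OF h]
    prod_diff_left prod_diff_right[OF f] prod_diff_right[OF g] prod_diff_right[OF h]
  have 1: "prod (prod f g) h = prod f (prod g h) + signed (eg \<and> eh) (prod (prod f h) g - prod f (prod h g))"
    using pre_lie[OF f g h] by (simp add: algebra_simps)
  have 2: "prod (prod g f) h = prod g (prod f h) + signed (ef \<and> eh) (prod (prod g h) f - prod g (prod h f))"
    using pre_lie[OF g f h] by (simp add: algebra_simps)
  have 3: "prod (prod h f) g = prod h (prod f g) + signed (ef \<and> eg) (prod (prod h g) f - prod h (prod g f))"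
    using pre_lie[OF h f g] by (simp add: algebra_simps)
  show ?thesis
    unfolding commutator_def
    by (cases ef; cases eg; cases eh; simp add: R 1 2 3 algebra_simps)
qed

end

locale derived_bracket = graded_pre_lie +
  fixes \<pi> :: 'a
  assumes \<pi>_odd: "\<pi> \<in> H True"
    and \<pi>_square: "prod \<pi> \<pi> = 0"
    and prod_\<pi>_\<pi>: "f \<in> H e \<Longrightarrow> prod (prod f \<pi>) \<pi> = 0"
begin

abbreviation differential :: "bool \<Rightarrow> 'a \<Rightarrow> 'a"
  where "differential e f \<equiv> commutator True e \<pi> f"

text \<open>
  The degree in which the derived bracket is graded is one more than that of the pre-Lie algebra, so
  its parity is \<open>\<not> e\<close>. The sign in front turns the Leibniz identity into the graded Jacobi identity.
\<close>

definition derived :: "bool \<Rightarrow> bool \<Rightarrow> 'a \<Rightarrow> 'a \<Rightarrow> 'a"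
  where "derived e e' f g = signed (\<not> e) (commutator (\<not> e) e' (differential e f) g)"

lemma H_differential: "f \<in> H e \<Longrightarrow> differential e f \<in> H (\<not> e)"
  using H_commutator[OF \<pi>_odd, of f e] by simp

text \<open>
  Of the four terms, \<open>(f \<pi>) \<pi>\<close> vanishes by assumption. The other three cancel by the pre-Lie identity
  for \<open>\<pi>\<close>, \<open>\<pi>\<close> and \<open>f\<close>, in which \<open>(\<pi> \<pi>) f\<close> is zero.
\<close>

lemma differential_differential:
  assumes f: "f \<in> H e"
  shows "differential (\<not> e) (differential e f) = 0"
proof -
  note R = prod_add_left prod_minus_left prod_add_right[OF f] prod_minus_right[OF f]
    prod_add_right[OF \<pi>_odd] prod_minus_right[OF \<pi>_odd]
    prod_diff_left prod_diff_right[OF f] prod_diff_right[OF \<pi>_odd] \<pi>_square prod_\<pi>_\<pi>[OF f]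
  have zero: "prod 0 f = 0" using prod_add_left[of 0 0 f] by simp
  have 1: "prod (prod \<pi> \<pi>) f - prod \<pi> (prod \<pi> f)
      = signed e (prod (prod \<pi> f) \<pi> - prod \<pi> (prod f \<pi>))"
    using pre_lie[OF \<pi>_odd \<pi>_odd f] by simp
  have 2: "prod \<pi> (prod \<pi> f) = signed e (prod \<pi> (prod f \<pi>) - prod (prod \<pi> f) \<pi>)"
    using 1 zero by (cases e) (simp_all add: \<pi>_square algebra_simps)
  show ?thesis
    unfolding commutator_def
    by (cases e; simp add: R 2 algebra_simps)
qed

text \<open>
  This is the Jacobi identity for \<open>[\<pi>, f]\<close>, \<open>[\<pi>, g]\<close> and \<open>h\<close>, as \<open>[[\<pi>, f], [\<pi>, g]]\<close> equals
  \<open>[\<pi>, [[\<pi>, f], g]]\<close> up to sign.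
\<close>

lemma derived_jacobi:
  assumes f: "f \<in> H ef" and g: "g \<in> H eg" and h: "h \<in> H eh"
  shows "derived ef (eg = eh) f (derived eg eh g h)
    = derived (ef = eg) eh (derived ef eg f g) h
      + signed (\<not> ef \<and> \<not> eg) (derived eg (ef = eh) g (derived ef eh f h))"
proof -
  let ?df = "differential ef f" and ?dg = "differential eg g"
  note df = H_differential[OF f] and dg = H_differential[OF g]
  have dfg: "commutator (\<not> ef) eg ?df g \<in> H (ef = eg)"
    using H_commutator[OF df g] by (cases ef) simp_all
  have "differential (ef = eg) (commutator (\<not> ef) eg ?df g)
      = commutator ef eg (differential (\<not> ef) ?df) g + signed (\<not> ef) (commutator (\<not> ef) (\<not> eg) ?df ?dg)"
    using commutator_jacobi[OF \<pi>_odd df g] by (cases ef; cases eg) simp_all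
  also have "differential (\<not> ef) ?df = 0" by (rule differential_differential[OF f])
  also have "commutator ef eg 0 g = 0"
    using commutator_minus_left[OF g, of ef eg 0] prod_add_left[of 0 0 g] prod_add_right[OF g, of 0 0]
    by (simp add: commutator_def)
  finally have d: "differential (ef = eg) (commutator (\<not> ef) eg ?df g)
      = signed (\<not> ef) (commutator (\<not> ef) (\<not> eg) ?df ?dg)" by simp
  have J: "commutator (\<not> ef) (eg = eh) ?df (commutator (\<not> eg) eh ?dg h)
    = commutator (ef \<noteq> eg) eh (commutator (\<not> ef) (\<not> eg) ?df ?dg) h
      + signed (\<not> ef \<and> \<not> eg) (commutator (\<not> eg) (ef = eh) ?dg (commutator (\<not> ef) eh ?df h))"
    using commutator_jacobi[OF df dg h] by (cases ef; cases eg; cases eh) simp_all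
  show ?thesis
    unfolding derived_def
    using J d commutator_minus_right[OF \<pi>_odd] commutator_minus_right[OF df]
      commutator_minus_right[OF dg] commutator_minus_left[OF h]
    by (cases ef; cases eg; cases eh) simp_all
qed

end

section \<open>The bracket on functions of words\<close>

text \<open>
  The value \<open>a\<close> between the words \<open>p\<close> and \<open>s\<close> acts to the right. The end of the word plays the part of a
  last letter \<open>1\<close> in a unital extension of \<open>A\<close>, which multiplies the value of \<open>F\<close>.
\<close>

definition next_insertion ::
    "('a \<Rightarrow> 'y \<Rightarrow> 'y) \<Rightarrow> ('y list \<Rightarrow> 'a::ring) \<Rightarrow> 'y list \<Rightarrow> 'a \<Rightarrow> 'y list \<Rightarrow> 'a"
  where "next_insertion l F p a s = (if s = [] then F p * a else F (p @ l a (hd s) # tl s))"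

text \<open>
  At the beginning of the word there is no letter to act on and the term is \<open>0\<close>: the product \<open>a * F s\<close>
  appears in the bracket as an end term of the insertion with the two maps exchanged.
\<close>

definition previous_insertion ::
    "('y \<Rightarrow> 'a \<Rightarrow> 'y) \<Rightarrow> ('y list \<Rightarrow> 'a::ring) \<Rightarrow> 'y list \<Rightarrow> 'a \<Rightarrow> 'y list \<Rightarrow> 'a"
  where "previous_insertion r F p a s = (if p = [] then 0 else F (butlast p @ r (last p) a # s))"

text \<open>
  For \<open>e\<close> true the sign is multiplied by that of exchanging the two maps, whose degrees are read off as
  \<open>length q\<close> and \<open>length p + length s\<close>. Thus the bracket below is defined for
  inhomogeneous maps, and bilinear.
\<close>

definition insertion ::
    "('a \<Rightarrow> 'y \<Rightarrow> 'y) \<Rightarrow> ('y \<Rightarrow> 'a \<Rightarrow> 'y) \<Rightarrow> bool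
      \<Rightarrow> ('y list \<Rightarrow> 'a::ring) \<Rightarrow> ('y list \<Rightarrow> 'a) \<Rightarrow> 'y list \<Rightarrow> 'a"
  where "insertion l r e F G w = (\<Sum>(p, q, s)\<in>splits w.
    signed (odd (length p * length q) \<noteq> (e \<and> odd (length q * (length p + length s))))
      (next_insertion l F p (G q) s - previous_insertion r F p (G q) s))"

definition bracket ::
    "('a \<Rightarrow> 'y \<Rightarrow> 'y) \<Rightarrow> ('y \<Rightarrow> 'a \<Rightarrow> 'y)
      \<Rightarrow> ('y list \<Rightarrow> 'a::ring) \<Rightarrow> ('y list \<Rightarrow> 'a) \<Rightarrow> 'y list \<Rightarrow> 'a"
  where "bracket l r F G w = insertion l r False F G w - insertion l r True G F w"

definition of_degree :: "nat \<Rightarrow> ('y list \<Rightarrow> 'b::zero) \<Rightarrow> bool"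
  where "of_degree m F \<longleftrightarrow> (\<forall>w. F w \<noteq> 0 \<longrightarrow> length w = m)"

lemma of_degreeD: "of_degree m F \<Longrightarrow> length w \<noteq> m \<Longrightarrow> F w = 0"
  unfolding of_degree_def by blast

text \<open>
  A common frame for words over a bimodule and for words of labelled vectors, with \<open>comb\<close> as the
  partial linear structure of the letters.
\<close>

locale letter_bimodule = associative_algebra scale
  for scale :: "'k::comm_ring_1 \<Rightarrow> 'a::ring \<Rightarrow> 'a" +
  fixes comb :: "'k \<Rightarrow> 'y \<Rightarrow> 'y \<Rightarrow> 'y \<Rightarrow> bool"
    and l :: "'a \<Rightarrow> 'y \<Rightarrow> 'y" and r :: "'y \<Rightarrow> 'a \<Rightarrow> 'y"
  assumes comb_l: "comb c u v w \<Longrightarrow> comb c (l a u) (l a v) (l a w)"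
    and comb_r: "comb c u v w \<Longrightarrow> comb c (r u a) (r v a) (r w a)"
    and comb_l_algebra: "comb c (l a y) (l b y) (l (scale c a + b) y)"
    and comb_r_algebra: "comb c (r y a) (r y b) (r y (scale c a + b))"
begin

lemma zero_letter:
  assumes "multilinear comb scale F"
  shows "F (p @ l 0 y # s) = 0" "F (p @ r y 0 # s) = 0"
  using multilinearD[OF assms comb_l_algebra[of 1 0 y 0], of p s]
    multilinearD[OF assms comb_r_algebra[of 1 y 0 0], of p s] by simp_all

lemma next_insertion_algebra:
  assumes F: "multilinear comb scale F"
  shows "next_insertion l F p (scale c a + b) s
    = scale c (next_insertion l F p a s) + next_insertion l F p b s"
  using multilinearD[OF F comb_l_algebra]
  by (simp add: next_insertion_def distrib_left mult_scale_right)

lemma previous_insertion_algebra: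
  assumes F: "multilinear comb scale F"
  shows "previous_insertion r F p (scale c a + b) s
    = scale c (previous_insertion r F p a s) + previous_insertion r F p b s"
  using multilinearD[OF F comb_r_algebra]
  by (simp add: previous_insertion_def)

lemma next_insertion_right:
  assumes F: "multilinear comb scale F" and w: "comb c u v w"
  shows "next_insertion l F p a (s @ w # t)
    = scale c (next_insertion l F p a (s @ u # t)) + next_insertion l F p a (s @ v # t)"
  using multilinearD[OF F comb_l[OF w], of p a t]
    multilinearD[OF F w, of "p @ l a (hd s) # tl s" t]
  by (cases s) (simp_all add: next_insertion_def)

lemma next_insertion_left:
  assumes F: "multilinear comb scale F" and w: "comb c u v w"
  shows "next_insertion l F (t @ w # p) a s
    = scale c (next_insertion l F (t @ u # p) a s) + next_insertion l F (t @ v # p) a s"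
  using multilinearD[OF F w, of t p] multilinearD[OF F w, of t "p @ l a (hd s) # tl s"]
  by (cases s) (simp_all add: next_insertion_def distrib_right mult_scale_left)

lemma previous_insertion_right:
  assumes F: "multilinear comb scale F" and w: "comb c u v w"
  shows "previous_insertion r F p a (s @ w # t)
    = scale c (previous_insertion r F p a (s @ u # t)) + previous_insertion r F p a (s @ v # t)"
  using multilinearD[OF F w, of "butlast p @ r (last p) a # s" t]
  by (simp add: previous_insertion_def)

lemma previous_insertion_left:
  assumes F: "multilinear comb scale F" and w: "comb c u v w"
  shows "previous_insertion r F (t @ w # p) a s
    = scale c (previous_insertion r F (t @ u # p) a s) + previous_insertion r F (t @ v # p) a s"
  using multilinearD[OF F comb_r[OF w], of t a s]
    multilinearD[OF F w, of t "butlast p @ r (last p) a # s"]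
  by (cases p rule: rev_cases) (simp_all add: previous_insertion_def butlast_append)

lemma multilinear_insertion:
  assumes F: "multilinear comb scale F" and G: "multilinear comb scale G"
  shows "multilinear comb scale (insertion l r e F G)"
  unfolding multilinear_def
proof (intro allI impI)
  fix a b c u v w
  assume w: "comb c u v w"
  show "insertion l r e F G (a @ w # b)
    = scale c (insertion l r e F G (a @ u # b)) + insertion l r e F G (a @ v # b)"
    unfolding insertion_def sum_splits_Cons_middle
    by (simp add: next_insertion_right[OF F w] next_insertion_left[OF F w]
        previous_insertion_right[OF F w] previous_insertion_left[OF F w]
        multilinearD[OF G w] next_insertion_algebra[OF F] previous_insertion_algebra[OF F]
        scale_signed signed_add signed_diff scale_right_diff_distrib
        scale_right_distrib scale_sum_right sum.distrib sum_subtractf split_def)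
qed

lemma multilinear_diff:
  assumes F: "multilinear comb scale F" and G: "multilinear comb scale G"
  shows "multilinear comb scale (\<lambda>w. F w - G w)"
  unfolding multilinear_def
  using multilinearD[OF F] multilinearD[OF G] by (simp add: scale_right_diff_distrib)

lemma multilinear_bracket:
  assumes "multilinear comb scale F" "multilinear comb scale G"
  shows "multilinear comb scale (bracket l r F G)"
  unfolding bracket_def[abs_def] using assms by (intro multilinear_diff multilinear_insertion)

lemma insertion_of_degree:
  assumes F: "multilinear comb scale F" and m: "of_degree m F" and n: "of_degree n G"
  shows "of_degree (m + n) (insertion l r e F G)"
  unfolding of_degree_def
proof (intro allI impI)
  fix w assume nonzero: "insertion l r e F G w \<noteq> 0"
  have "\<exists>(p, q, s)\<in>splits w. next_insertion l F p (G q) s \<noteq> 0 \<or> previous_insertion r F p (G q) s \<noteq> 0"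
  proof (rule ccontr)
    assume "\<not> ?thesis"
    then have "insertion l r e F G w = 0"
      unfolding insertion_def by (intro sum.neutral) auto
    with nonzero show False by contradiction
  qed
  then obtain p q s where w: "w = p @ q @ s"
    and nz: "next_insertion l F p (G q) s \<noteq> 0 \<or> previous_insertion r F p (G q) s \<noteq> 0"
    by auto
  have "G q \<noteq> 0"
    using nz zero_letter[OF F] zero_letter(1)[OF F, of "[]"] by (auto simp: next_insertion_def previous_insertion_def split: if_splits)
  then have "length q = n" using of_degreeD[OF n] by blast
  moreover have "length p + length s = m"
  proof (rule ccontr)
    assume "length p + length s \<noteq> m"
    then have "next_insertion l F p (G q) s = 0" "previous_insertion r F p (G q) s = 0"
      by (cases p rule: rev_cases;
          auto simp: next_insertion_def previous_insertion_def of_degreeD[OF m])+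
    with nz show False by simp
  qed
  ultimately show "length w = m + n" by (simp add: w)
qed

lemma bracket_of_degree:
  assumes "multilinear comb scale F" "of_degree m F" "multilinear comb scale G" "of_degree n G"
  shows "of_degree (m + n) (bracket l r F G)"
  unfolding of_degree_def
proof (intro allI impI)
  fix w assume "bracket l r F G w \<noteq> 0"
  then have "insertion l r False F G w \<noteq> 0 \<or> insertion l r True G F w \<noteq> 0"
    by (auto simp: bracket_def)
  then show "length w = m + n"
    using of_degreeD[OF insertion_of_degree[OF assms(1,2,4), of False], of w]
      of_degreeD[OF insertion_of_degree[OF assms(3,4,2), of True], of w]
    by (cases "length w = m + n") (auto simp: add.commute)
qed

text \<open>
  All nonzero terms have \<open>length q = n\<close> and \<open>length p + length s = m\<close>.
\<close>

lemma insertion_twisted_homogeneous: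
  assumes F: "multilinear comb scale F" and m: "of_degree m F" and n: "of_degree n G"
  shows "insertion l r True F G w = signed (odd (m * n)) (insertion l r False F G w)"
proof -
  have "signed (odd (length p * length q) \<noteq> (True \<and> odd (length q * (length p + length s))))
      (next_insertion l F p (G q) s - previous_insertion r F p (G q) s)
    = signed (odd (m * n)) (signed (odd (length p * length q) \<noteq> (False \<and> odd (length q * (length p + length s))))
      (next_insertion l F p (G q) s - previous_insertion r F p (G q) s))" for p q s
  proof (cases "length q = n \<and> length p + length s = m")
    case True
    then show ?thesis by (auto simp: signed_def)
  next
    case False
    have "next_insertion l F p (G q) s = 0 \<and> previous_insertion r F p (G q) s = 0"
    proof (cases "length q = n")
      case True
      with False have "length p + length s \<noteq> m" by simp
      then show ?thesis
        by (cases p rule: rev_cases)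
          (auto simp: next_insertion_def previous_insertion_def of_degreeD[OF m])
    next
      case False
      then show ?thesis
        using of_degreeD[OF n, of q] zero_letter[OF F]
        by (simp add: next_insertion_def previous_insertion_def)
    qed
    then show ?thesis by simp
  qed
  then show ?thesis unfolding insertion_def signed_sum split_def by simp
qed

lemma bracket_skew_symmetric:
  assumes F: "multilinear comb scale F" "of_degree m F" and G: "multilinear comb scale G" "of_degree n G"
  shows "bracket l r F G w = - signed (odd (m * n)) (bracket l r G F w)"
  unfolding bracket_def
  using insertion_twisted_homogeneous[OF F G(2), of w] insertion_twisted_homogeneous[OF G F(2), of w]
  by (auto simp: signed_def mult.commute)

lemma insertion_linear_left:
  "insertion l r e (\<lambda>w. scale c (F w) + F' w) G w
    = scale c (insertion l r e F G w) + insertion l r e F' G w"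
proof -
  have "next_insertion l (\<lambda>w. scale c (F w) + F' w) p a s
      = scale c (next_insertion l F p a s) + next_insertion l F' p a s" for p a s
    by (simp add: next_insertion_def distrib_right mult_scale_left)
  moreover have "previous_insertion r (\<lambda>w. scale c (F w) + F' w) p a s
      = scale c (previous_insertion r F p a s) + previous_insertion r F' p a s" for p a s
    by (simp add: previous_insertion_def)
  ultimately show ?thesis
    unfolding insertion_def
    by (simp add: scale_signed signed_add signed_diff scale_right_diff_distrib
        scale_right_distrib scale_sum_right sum.distrib sum_subtractf split_def)
qed

lemma insertion_linear_right:
  assumes F: "multilinear comb scale F"
  shows "insertion l r e F (\<lambda>w. scale c (G w) + G' w) w
    = scale c (insertion l r e F G w) + insertion l r e F G' w"
  unfolding insertion_def
  by (simp add: next_insertion_algebra[OF F] previous_insertion_algebra[OF F]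
      scale_signed signed_add signed_diff scale_right_diff_distrib
      scale_right_distrib scale_sum_right sum.distrib sum_subtractf split_def)

lemma bracket_linear_left:
  assumes G: "multilinear comb scale G"
  shows "bracket l r (\<lambda>w. scale c (F w) + F' w) G w
    = scale c (bracket l r F G w) + bracket l r F' G w"
  unfolding bracket_def insertion_linear_left insertion_linear_right[OF G]
  by (simp add: scale_right_diff_distrib)

lemma bracket_linear_right:
  assumes F: "multilinear comb scale F"
  shows "bracket l r F (\<lambda>w. scale c (G w) + G' w) w
    = scale c (bracket l r F G w) + bracket l r F G' w"
  unfolding bracket_def insertion_linear_left insertion_linear_right[OF F]
  by (simp add: scale_right_diff_distrib)

end

lemma insertion_map:
  assumes l: "\<And>a y. l' a (h y) = h (l a y)" and r: "\<And>a y. r' (h y) a = h (r y a)"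
  shows "insertion l' r' e F G (map h w) = insertion l r e (\<lambda>w. F (map h w)) (\<lambda>w. G (map h w)) w"
proof -
  have "next_insertion l' F (map h p) a (map h s) = next_insertion l (\<lambda>w. F (map h w)) p a s" for p a s
    by (simp add: next_insertion_def hd_map l map_tl)
  moreover have "previous_insertion r' F (map h p) a (map h s)
      = previous_insertion r (\<lambda>w. F (map h w)) p a s" for p a s
    by (simp add: previous_insertion_def last_map r map_butlast)
  ultimately show ?thesis unfolding insertion_def sum_splits_map by simp
qed

lemma bracket_map:
  assumes "\<And>a y. l' a (h y) = h (l a y)" and "\<And>a y. r' (h y) a = h (r y a)"
  shows "bracket l' r' F G (map h w) = bracket l r (\<lambda>w. F (map h w)) (\<lambda>w. G (map h w)) w"
  unfolding bracket_def using insertion_map[of l' h l r' r, OF assms] by simp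

section \<open>The bracket as a derived bracket of the semidirect product\<close>

context bimodule
begin

lemma lact_simps [simp]:
  "lact (a + b) u = lact a u + lact b u" "lact a (u + v) = lact a u + lact a v"
  "lact (scaleA c a) u = scaleM c (lact a u)" "lact a (scaleM c u) = scaleM c (lact a u)"
  "lact 0 u = 0" "lact a 0 = 0"
  using module_hom.add[OF lact_linear_left] module_hom.scale[OF lact_linear_left]
    module_hom.zero[OF lact_linear_left] module_hom.add[OF lact_linear_right]
    module_hom.scale[OF lact_linear_right] module_hom.zero[OF lact_linear_right]
  by auto

lemma ract_simps [simp]:
  "ract u (a + b) = ract u a + ract u b" "ract (u + v) a = ract u a + ract v a"
  "ract u (scaleA c a) = scaleM c (ract u a)" "ract (scaleM c u) a = scaleM c (ract u a)"
  "ract u 0 = 0" "ract 0 a = 0"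
  using module_hom.add[OF ract_linear_left] module_hom.scale[OF ract_linear_left]
    module_hom.zero[OF ract_linear_left] module_hom.add[OF ract_linear_right]
    module_hom.scale[OF ract_linear_right] module_hom.zero[OF ract_linear_right]
  by auto

sublocale letters: letter_bimodule scaleA "lincomb scaleM" lact ract
  by standard (simp_all add: lincomb_def)

definition semidirect_scale :: "'k \<Rightarrow> 'a \<times> 'm \<Rightarrow> 'a \<times> 'm"
  where "semidirect_scale c x = (scaleA c (fst x), scaleM c (snd x))"

definition semidirect_mult :: "'a \<times> 'm \<Rightarrow> 'a \<times> 'm \<Rightarrow> 'a \<times> 'm"
  where "semidirect_mult x y = (fst x * fst y, lact (fst x) (snd y) + ract (snd x) (fst y))"

definition mult_cochain :: "('a \<times> 'm) list \<Rightarrow> 'a \<times> 'm"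
  where "mult_cochain w = (if length w = 2 then semidirect_mult (w ! 0) (w ! 1) else 0)"

definition lift_cochain :: "('m list \<Rightarrow> 'a) \<Rightarrow> ('a \<times> 'm) list \<Rightarrow> 'a \<times> 'm"
  where "lift_cochain F w = (F (map snd w), 0)"

sublocale semidirect: module semidirect_scale
  by standard (auto simp: semidirect_scale_def alg.scale_right_distrib alg.scale_left_distrib
      vec.scale_right_distrib vec.scale_left_distrib)

lemma semidirect_mult_simps:
  "semidirect_mult (x + y) z = semidirect_mult x z + semidirect_mult y z"
  "semidirect_mult x (y + z) = semidirect_mult x y + semidirect_mult x z"
  "semidirect_mult (semidirect_scale c x) y = semidirect_scale c (semidirect_mult x y)"
  "semidirect_mult x (semidirect_scale c y) = semidirect_scale c (semidirect_mult x y)"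
  "semidirect_mult 0 y = 0" "semidirect_mult x 0 = 0"
  by (auto simp: semidirect_mult_def semidirect_scale_def algebra_simps alg.scale_right_distrib
      vec.scale_right_distrib alg.mult_scale_left alg.mult_scale_right prod_eq_iff)

lemma semidirect_mult_assoc:
  "semidirect_mult (semidirect_mult x y) z = semidirect_mult x (semidirect_mult y z)"
  by (simp add: semidirect_mult_def lact_assoc lact_ract ract_assoc mult.assoc add.assoc)

lemma mult_cochain_pair [simp]: "mult_cochain [x, y] = semidirect_mult x y"
  by (simp add: mult_cochain_def)

lemma mult_cochain_eq_0: "length w \<noteq> 2 \<Longrightarrow> mult_cochain w = 0"
  by (simp add: mult_cochain_def)

lemma mult_cochain_slot:
  "mult_cochain (p @ x # s) = (if p = [] \<and> length s = 1 then semidirect_mult x (hd s) else 0)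
    + (if length p = 1 \<and> s = [] then semidirect_mult (hd p) x else 0)"
proof (cases "length (p @ x # s) = 2")
  case True
  then show ?thesis by (cases p; cases s) (auto simp: mult_cochain_def)
next
  case False
  then show ?thesis by (auto simp: mult_cochain_def length_Suc_conv)
qed

lemma multilinear_mult_cochain: "multilinear_map semidirect_scale semidirect_scale mult_cochain"
proof
  show "multilinear (lincomb semidirect_scale) semidirect_scale mult_cochain"
    by (auto simp: multilinear_def lincomb_def mult_cochain_slot semidirect_mult_simps)
qed

lemma homogeneous_mult_cochain: "homogeneous True mult_cochain"
  by (auto simp: homogeneous_def mult_cochain_def split: if_splits)

lemma circ_mult_cochain:
  "circ mult_cochain g w = (if w = [] then 0 else semidirect_mult (g (butlast w)) (last w)
    + signed (odd (length w)) (semidirect_mult (hd w) (g (tl w))))"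
proof -
  have "circ mult_cochain g w
      = (\<Sum>(p, q, s)\<in>splits w. if p = [] \<and> length s = 1 then semidirect_mult (g q) (hd s) else 0)
      + (\<Sum>(p, q, s)\<in>splits w. if length p = 1 \<and> s = []
          then signed (even (length q)) (semidirect_mult (hd p) (g q)) else 0)"
    unfolding circ_def mult_cochain_slot sum.distrib[symmetric]
    by (auto simp: signed_add intro!: sum.cong)
  then show ?thesis
    unfolding sum_splits_all_but_last[where f = "\<lambda>q. semidirect_mult (g q)"]
      sum_splits_all_but_first[where f = "\<lambda>x q. signed (even (length q)) (semidirect_mult x (g q))"]
    by (cases w) auto
qed

lemma circ_mult_cochain_mult_cochain: "circ mult_cochain mult_cochain = 0"
proof
  fix w :: "('a \<times> 'm) list"
  show "circ mult_cochain mult_cochain w = 0 w"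
  proof (cases "length w = 3")
    case False
    then show ?thesis
      by (simp add: circ_mult_cochain mult_cochain_eq_0 semidirect_mult_simps)
  next
    case True
    then obtain x y z where w: "w = [x, y, z]" by (auto simp: numeral_3_eq_3 length_Suc_conv)
    then show ?thesis by (simp add: circ_mult_cochain semidirect_mult_assoc)
  qed
qed

definition semidirect_cochains :: "bool \<Rightarrow> (('a \<times> 'm) list \<Rightarrow> 'a \<times> 'm) set"
  where "semidirect_cochains e =
    {f. multilinear_map semidirect_scale semidirect_scale f \<and> homogeneous e f}"

sublocale semidirect: derived_bracket semidirect_cochains circ mult_cochain
proof
  fix e e' eg eh and f f' g g' h :: "('a \<times> 'm) list \<Rightarrow> 'a \<times> 'm"
  show "f \<in> semidirect_cochains e \<Longrightarrow> g \<in> semidirect_cochains e \<Longrightarrow> f + g \<in> semidirect_cochains e"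
    by (auto simp: semidirect_cochains_def homogeneous_def multilinear_map_def
        multilinear_map_axioms_def multilinear_def lincomb_def semidirect.scale_right_distrib)
      (metis add_0)+
  show "f \<in> semidirect_cochains e \<Longrightarrow> - f \<in> semidirect_cochains e"
    by (auto simp: semidirect_cochains_def homogeneous_def multilinear_map_def
        multilinear_map_axioms_def multilinear_def lincomb_def)
  show "f \<in> semidirect_cochains e \<Longrightarrow> g \<in> semidirect_cochains e'
      \<Longrightarrow> circ f g \<in> semidirect_cochains (e \<noteq> e')"
    unfolding semidirect_cochains_def
    using semidirect.multilinear_circ homogeneous_circ by blast
  show "circ (f + f') g = circ f g + circ f' g" by (rule circ_add_left)
  show "circ (- f) g = - circ f g" by (rule circ_minus_left)
  show "f \<in> semidirect_cochains e \<Longrightarrow> circ f (g + g') = circ f g + circ f g'"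
    unfolding semidirect_cochains_def using circ_add_right by blast
  show "f \<in> semidirect_cochains e \<Longrightarrow> circ f (- g) = - circ f g"
    unfolding semidirect_cochains_def using circ_minus_right by blast
  show "f \<in> semidirect_cochains e \<Longrightarrow> g \<in> semidirect_cochains eg \<Longrightarrow> h \<in> semidirect_cochains eh
    \<Longrightarrow> circ (circ f g) h - circ f (circ g h) = signed (eg \<and> eh) (circ (circ f h) g - circ f (circ h g))"
    unfolding semidirect_cochains_def using circ_pre_lie by blast
  show "mult_cochain \<in> semidirect_cochains True"
    by (simp add: semidirect_cochains_def multilinear_mult_cochain homogeneous_mult_cochain)
  show "circ mult_cochain mult_cochain = 0" by (rule circ_mult_cochain_mult_cochain)
  show "circ (circ f mult_cochain) mult_cochain = 0" if "f \<in> semidirect_cochains e"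
  proof -
    have f: "multilinear_map semidirect_scale semidirect_scale f"
      using that by (simp add: semidirect_cochains_def)
    have "circ (circ f mult_cochain) mult_cochain = circ f 0"
      using circ_circ_odd[OF f homogeneous_mult_cochain] circ_mult_cochain_mult_cochain by simp
    also have "\<dots> = 0" using circ_add_right[OF f, of 0 0] by simp
    finally show ?thesis .
  qed
qed

text \<open>
  The terms of an insertion that multiply two values, as opposed to those in which a value acts on a letter.
\<close>

definition boundary_insertion :: "('m list \<Rightarrow> 'a) \<Rightarrow> ('m list \<Rightarrow> 'a) \<Rightarrow> 'm list \<Rightarrow> 'a"
  where "boundary_insertion F G w = (\<Sum>(p, q)\<in>cuts w. signed (odd (length p * length q)) (F p * G q))"

definition bulk_insertion :: "('m list \<Rightarrow> 'a) \<Rightarrow> ('m list \<Rightarrow> 'a) \<Rightarrow> 'm list \<Rightarrow> 'a"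
  where "bulk_insertion F G w = (\<Sum>(p, q, s)\<in>splits w. signed (odd (length p * length q))
    ((if s = [] then 0 else F (p @ lact (G q) (hd s) # tl s)) - previous_insertion ract F p (G q) s))"

lemma insertion_eq:
  "insertion lact ract False F G w = bulk_insertion F G w + boundary_insertion F G w"
proof -
  have "insertion lact ract False F G w = bulk_insertion F G w
    + (\<Sum>(p, q, s)\<in>splits w. if s = [] then signed (odd (length p * length q)) (F p * G q) else 0)"
    unfolding insertion_def bulk_insertion_def sum.distrib[symmetric]
    by (auto simp: next_insertion_def signed_add signed_diff intro!: sum.cong)
  then show ?thesis by (simp add: boundary_insertion_def sum_splits_empty_right)
qed

lemma lift_in_semidirect_cochains:
  assumes F: "multilinear_map scaleM scaleA F" and m: "of_degree m F"
  shows "lift_cochain F \<in> semidirect_cochains (even m)"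
proof -
  interpret F: multilinear_map scaleM scaleA F by fact
  have "multilinear (lincomb semidirect_scale) semidirect_scale (lift_cochain F)"
    by (auto simp: multilinear_def lincomb_def lift_cochain_def semidirect_scale_def F.slot_add
        F.slot_scale)
  moreover have "homogeneous (even m) (lift_cochain F)"
    using m by (auto simp: homogeneous_def lift_cochain_def of_degree_def zero_prod_def)
  ultimately show ?thesis by (auto simp: semidirect_cochains_def intro: multilinear_map.intro
      multilinear_map_axioms.intro semidirect.module_axioms)
qed

text \<open>
  The lifted cochains form an abelian subalgebra: an element of \<open>A\<close> has \<open>M\<close>-component \<open>0\<close>.
\<close>

lemma lift_cochain_slot_algebra:
  assumes "multilinear_map scaleM scaleA F"
  shows "lift_cochain F (p @ (a, 0) # s) = 0"
proof -
  interpret F: multilinear_map scaleM scaleA F by fact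
  show ?thesis by (simp add: lift_cochain_def zero_prod_def)
qed

lemma circ_mult_lift:
  "circ mult_cochain (lift_cochain F) w = (if w = [] then 0
    else (F (map snd (butlast w)) * fst (last w)
        + signed (odd (length w)) (fst (hd w) * F (map snd (tl w))),
      lact (F (map snd (butlast w))) (snd (last w))
        + signed (odd (length w)) (ract (snd (hd w)) (F (map snd (tl w))))))"
  by (simp add: circ_mult_cochain semidirect_mult_def lift_cochain_def signed_def)

text \<open>
  If \<open>(a, 0)\<close> is an argument of the lifted cochain, the term vanishes, so \<open>(a, 0)\<close> is the other factor of
  the product and stands at an end of the word.
\<close>

lemma circ_mult_lift_slot_algebra:
  assumes "multilinear_map scaleM scaleA F"
  shows "circ mult_cochain (lift_cochain F) (p @ (a, 0) # s)
    = ((if s = [] then F (map snd p) * a else 0)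
      + (if p = [] then signed (even (length s)) (a * F (map snd s)) else 0), 0)"
proof -
  interpret F: multilinear_map scaleM scaleA F by fact
  have 1: "F (map snd (butlast (p @ (a, 0) # s))) = (if s = [] then F (map snd p) else 0)"
    by (cases s rule: rev_cases) (simp_all add: butlast_append)
  have 2: "F (map snd (tl (p @ (a, 0) # s))) = (if p = [] then F (map snd s) else 0)"
    by (cases p) simp_all
  have 3: "s = [] \<Longrightarrow> last (p @ (a, 0) # s) = (a, 0)" "p = [] \<Longrightarrow> hd (p @ (a, 0) # s) = (a, 0)"
    by simp_all
  show ?thesis
    unfolding circ_mult_lift 1 2 using 3 by (cases "p = []"; cases "s = []") simp_all
qed

text \<open>
  The product has to consume \<open>(a, 0)\<close>, together with the letter on its left or on its right.
\<close>

lemma circ_lift_mult_slot_algebra: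
  assumes "multilinear_map scaleM scaleA F"
  shows "circ (lift_cochain F) mult_cochain (p @ (a, 0) # s)
    = (signed (odd (length p))
      ((if s = [] then 0 else F (map snd p @ lact a (snd (hd s)) # map snd (tl s)))
        - previous_insertion ract F (map snd p) a (map snd s)), 0)"
proof -
  interpret F: multilinear_map scaleM scaleA F by fact
  let ?R = "\<lambda>v s'. signed (odd (length p)) (lift_cochain F (p @ semidirect_mult (a, 0) v # s'))"
  let ?L = "\<lambda>p' v. signed (odd (length p')) (lift_cochain F (p' @ semidirect_mult v (a, 0) # s))"
  have zero: "lift_cochain F (p @ 0 # s) = 0" for p s
    using lift_cochain_slot_algebra[OF assms, of p 0 s] by (simp add: zero_prod_def)
  have "circ (lift_cochain F) mult_cochain (p @ (a, 0) # s)
    = (\<Sum>(p', q)\<in>cuts p. \<Sum>(r, s')\<in>cuts s.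
        signed (odd (length p' * (length (q @ (a, 0) # r) + 1)))
          (lift_cochain F (p' @ mult_cochain (q @ (a, 0) # r) # s')))"
    unfolding circ_def sum_splits_Cons_middle
    using lift_cochain_slot_algebra[OF assms, of "p' @ x # t" a s for p' x t]
      lift_cochain_slot_algebra[OF assms, of p a "t @ x # s'" for t x s']
    by simp
  also have "\<dots> = (\<Sum>(p', q)\<in>cuts p. \<Sum>(r, s')\<in>cuts s.
        (if q = [] then (if length r = 1 then ?R (hd r) s' else 0) else 0)
      + (if r = [] then (if length q = 1 then ?L p' (hd q) else 0) else 0))"
    by (intro sum_pair_cong) (auto simp: mult_cochain_slot zero signed_def)
  also have "\<dots> = (\<Sum>(p', q)\<in>cuts p. (if q = [] then (\<Sum>(r, s')\<in>cuts s. if length r = 1 then ?R (hd r) s' else 0) else 0))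
      + (\<Sum>(p', q)\<in>cuts p. \<Sum>(r, s')\<in>cuts s. if r = [] then (if length q = 1 then ?L p' (hd q) else 0) else 0)"
    unfolding sum.distrib[symmetric]
    by (auto simp: sum.distrib split_def intro!: sum.cong)
  also have "\<dots> = (if s = [] then 0 else ?R (hd s) (tl s))
      + (if p = [] then 0 else ?L (butlast p) (last p))"
    unfolding sum_cuts_empty_left sum_cuts_empty_right sum_cuts_first[where f = ?R]
      sum_cuts_last[where f = ?L] by simp
  also have "\<dots> = (signed (odd (length p))
      ((if s = [] then 0 else F (map snd p @ lact a (snd (hd s)) # map snd (tl s)))
        - previous_insertion ract F (map snd p) a (map snd s)), 0)"
    by (cases p rule: rev_cases)
      (auto simp: lift_cochain_def semidirect_mult_def previous_insertion_def signed_def map_butlast last_map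
        zero_prod_def)
  finally show ?thesis .
qed

lemma circ_circ_mult_lift_lift:
  assumes F: "multilinear_map scaleM scaleA F" and m: "of_degree m F"
  shows "circ (circ mult_cochain (lift_cochain F)) (lift_cochain G)
    = lift_cochain (\<lambda>w. signed (odd m)
        (boundary_insertion F G w - (\<Sum>(q, s)\<in>cuts w. G q * F s)))"
proof
  fix w
  have "circ (circ mult_cochain (lift_cochain F)) (lift_cochain G) w
    = (\<Sum>(p, q, s)\<in>splits w. 
        ((\<lambda>p q s. (if s = [] then signed (odd m) (signed (odd (length p * length q)) (F p * G q)) else 0)
          - (if p = [] then signed (odd m) (G q * F s) else 0)) (map snd p) (map snd q) (map snd s), 0))"
    unfolding circ_def[of "circ mult_cochain (lift_cochain F)"]
  proof (intro sum_triple_cong)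
    fix p q s assume "(p, q, s) \<in> splits w"
    \<comment> \<open>Nonzero values of \<open>F\<close> occur only at words of length \<open>m\<close>, which makes the sign a common factor.\<close>
    have "signed (odd (length p * (length q + 1))) (F (map snd p) * a)
        = signed (odd m) (signed (odd (length p * length q)) (F (map snd p) * a))" for a
      using of_degreeD[OF m, of "map snd p"] by (cases "length p = m") (auto simp: signed_def)
    moreover have "signed (even (length s)) (a * F (map snd s)) = - signed (odd m) (a * F (map snd s))" for a
      using of_degreeD[OF m, of "map snd s"] by (cases "length s = m") (auto simp: signed_def)
    ultimately show "signed (odd (length p * (length q + 1)))
        (circ mult_cochain (lift_cochain F) (p @ lift_cochain G q # s))
      = ((\<lambda>p q s. (if s = [] then signed (odd m) (signed (odd (length p * length q)) (F p * G q)) else 0)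
          - (if p = [] then signed (odd m) (G q * F s) else 0)) (map snd p) (map snd q) (map snd s), 0)"
      unfolding lift_cochain_def[of G] circ_mult_lift_slot_algebra[OF F]
      by (cases "p = []"; cases "s = []") (auto simp: signed_def)
  qed
  also have "\<dots> = (\<Sum>(p, q, s)\<in>splits (map snd w).
      (if s = [] then signed (odd m) (signed (odd (length p * length q)) (F p * G q)) else 0)
          - (if p = [] then signed (odd m) (G q * F s) else 0), 0)"
    unfolding sum_splits_map by (simp add: split_def sum_Pair_zero)
  also have "\<dots> = lift_cochain (\<lambda>w. signed (odd m)
        (boundary_insertion F G w - (\<Sum>(q, s)\<in>cuts w. G q * F s))) w"
  proof -
    have "(\<Sum>(p, q, s)\<in>splits w'.
      (if s = [] then signed (odd m) (signed (odd (length p * length q)) (F p * G q)) else 0)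
          - (if p = [] then signed (odd m) (G q * F s) else 0))
      = (\<Sum>(p, q, s)\<in>splits w'. if s = [] then signed (odd m) (signed (odd (length p * length q)) (F p * G q)) else 0)
      - (\<Sum>(p, q, s)\<in>splits w'. if p = [] then signed (odd m) (G q * F s) else 0)" for w'
      by (simp add: split_def sum_subtractf)
    then show ?thesis
      unfolding sum_splits_empty_left sum_splits_empty_right
      by (simp add: lift_cochain_def boundary_insertion_def signed_sum signed_diff split_def)
  qed
  finally show "circ (circ mult_cochain (lift_cochain F)) (lift_cochain G) w
    = lift_cochain (\<lambda>w. signed (odd m)
        (boundary_insertion F G w - (\<Sum>(q, s)\<in>cuts w. G q * F s))) w" .
qed

lemma circ_circ_lift_mult_lift:
  assumes F: "multilinear_map scaleM scaleA F"
  shows "circ (circ (lift_cochain F) mult_cochain) (lift_cochain G)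
    = lift_cochain (bulk_insertion F G)"
proof
  fix w
  show "circ (circ (lift_cochain F) mult_cochain) (lift_cochain G) w
    = lift_cochain (bulk_insertion F G) w"
    unfolding circ_def[of "circ (lift_cochain F) mult_cochain"] lift_cochain_def[of G]
      lift_cochain_def[of "bulk_insertion F G"]
      circ_lift_mult_slot_algebra[OF F] bulk_insertion_def sum_splits_map sum_Pair_zero[symmetric]
    by (auto simp: signed_def hd_map map_tl intro!: sum.cong)
qed

lemma circ_lift_circ_mult_lift:
  assumes G: "multilinear_map scaleM scaleA G"
  shows "circ (lift_cochain G) (circ mult_cochain (lift_cochain F))
    = lift_cochain (bulk_insertion G F)"
proof
  fix w
  interpret G: multilinear_map scaleM scaleA G by fact
  have "circ (lift_cochain G) (circ mult_cochain (lift_cochain F)) w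
    = (\<Sum>(p, q, s)\<in>splits w. ((\<lambda>p q s. 
        (if q = [] then 0 else signed (odd (length p * length (butlast q)))
            (G (p @ lact (F (butlast q)) (last q) # s)))
      - (if q = [] then 0 else signed (odd ((length p + 1) * length (tl q)))
            (G (p @ ract (hd q) (F (tl q)) # s)))) (map snd p) (map snd q) (map snd s), 0))"
    unfolding circ_def[of "lift_cochain G"] circ_mult_lift
  proof (intro sum_triple_cong)
    fix p q s
    show "signed (odd (length p * (length q + 1)))
        (lift_cochain G (p @ (if q = [] then 0 else (F (map snd (butlast q)) * fst (last q)
        + signed (odd (length q)) (fst (hd q) * F (map snd (tl q))),
      lact (F (map snd (butlast q))) (snd (last q))
        + signed (odd (length q)) (ract (snd (hd q)) (F (map snd (tl q)))))) # s))
      = ((\<lambda>p q s. 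
        (if q = [] then 0 else signed (odd (length p * length (butlast q)))
            (G (p @ lact (F (butlast q)) (last q) # s)))
      - (if q = [] then 0 else signed (odd ((length p + 1) * length (tl q)))
            (G (p @ ract (hd q) (F (tl q)) # s)))) (map snd p) (map snd q) (map snd s), 0)"
      by (cases "q = []"; cases "even (length q)"; cases "even (length p)")
        (simp_all add: lift_cochain_def G.slot_add G.slot_minus G.slot_diff hd_map last_map map_tl map_butlast)
  qed
  also have "\<dots> = (\<Sum>(p, q, s)\<in>splits (map snd w).
        (if q = [] then 0 else signed (odd (length p * length (butlast q)))
            (G (p @ lact (F (butlast q)) (last q) # s)))
      - (if q = [] then 0 else signed (odd ((length p + 1) * length (tl q)))
            (G (p @ ract (hd q) (F (tl q)) # s))), 0)"
    unfolding sum_splits_map by (simp add: split_def sum_Pair_zero)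
  also have "\<dots> = lift_cochain (bulk_insertion G F) w"
  proof -
    have "(\<Sum>(p, q, s)\<in>splits w'.
        (if q = [] then 0 else signed (odd (length p * length (butlast q)))
            (G (p @ lact (F (butlast q)) (last q) # s)))
      - (if q = [] then 0 else signed (odd ((length p + 1) * length (tl q)))
            (G (p @ ract (hd q) (F (tl q)) # s))))
      = (\<Sum>(p, q, s)\<in>splits w'. if q = [] then 0 else signed (odd (length p * length (butlast q)))
            (G (p @ lact (F (butlast q)) (last q) # s)))
      - (\<Sum>(p, q, s)\<in>splits w'. if q = [] then 0 else signed (odd ((length p + 1) * length (tl q)))
            (G (p @ ract (hd q) (F (tl q)) # s)))" for w'
      by (simp add: split_def sum_subtractf)
    also have "\<dots> w' = (\<Sum>(p, q, s)\<in>splits w'. if s = [] then 0 else signed (odd (length p * length q))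
            (G (p @ lact (F q) (hd s) # tl s)))
      - (\<Sum>(p, q, s)\<in>splits w'. if p = [] then 0 else signed (odd ((length (butlast p) + 1) * length q))
            (G (butlast p @ ract (last p) (F q) # s)))" for w'
      unfolding sum_splits_move_last[where
          f = "\<lambda>p q v s. signed (odd (length p * length q)) (G (p @ lact (F q) v # s))"]
        sum_splits_move_first[where
          f = "\<lambda>p v q s. signed (odd ((length p + 1) * length q)) (G (p @ ract v (F q) # s))"] ..
    also have "\<dots> w' = bulk_insertion G F w'" for w'
      unfolding bulk_insertion_def previous_insertion_def sum_subtractf[symmetric]
      by (intro sum.cong) (auto simp: signed_def)
    finally show ?thesis by (simp add: lift_cochain_def)
  qed
  finally show "circ (lift_cochain G) (circ mult_cochain (lift_cochain F)) w
      = lift_cochain (bulk_insertion G F) w" .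
qed

lemma circ_lift_circ_lift_mult:
  assumes G: "multilinear_map scaleM scaleA G"
  shows "circ (lift_cochain G) (circ (lift_cochain F) mult_cochain) = 0"
proof
  fix w
  have "snd (circ (lift_cochain F) mult_cochain q) = 0" for q
    by (simp add: circ_def snd_sum split_def lift_cochain_def signed_def if_distrib[of snd] cong: if_cong)
  then have "lift_cochain G (p @ circ (lift_cochain F) mult_cochain q # s) = 0" for p q s
    using lift_cochain_slot_algebra[OF G] by (metis prod.collapse)
  then show "circ (lift_cochain G) (circ (lift_cochain F) mult_cochain) w = 0 w"
    unfolding circ_def[of "lift_cochain G"] by simp
qed

text \<open>
  The commutators expand into four compositions of \<open>\<pi>\<close> with the two lifts. One gives the products of
  values, one vanishes, and the other two give the actions on letters: of the values of \<open>G\<close> in the slots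
  of \<open>F\<close>, and of the values of \<open>F\<close> in the slots of \<open>G\<close>.
\<close>

lemma lift_bracket:
  assumes F: "multilinear_map scaleM scaleA F" and m: "of_degree m F"
    and G: "multilinear_map scaleM scaleA G" and n: "of_degree n G"
  shows "lift_cochain (bracket lact ract F G)
    = semidirect.derived (even m) (even n) (lift_cochain F) (lift_cochain G)"
proof
  fix w :: "('a \<times> 'm) list"
  let ?w = "map snd w"
  note G' = multilinear_map.multilinear[OF G]
  \<comment> \<open>The products in which the value of \<open>G\<close> comes first are end terms of the insertion of \<open>F\<close> into
    \<open>G\<close>.\<close>
  have bd: "(\<Sum>(q, s)\<in>cuts ?w. G q * F s) = signed (odd (m * n)) (boundary_insertion G F ?w)"
    unfolding boundary_insertion_def signed_sum split_def
  proof (intro sum.cong refl)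
    fix x
    show "G (fst x) * F (snd x)
      = signed (odd (m * n)) (signed (odd (length (fst x) * length (snd x))) (G (fst x) * F (snd x)))"
      using of_degreeD[OF m, of "snd x"] of_degreeD[OF n, of "fst x"]
      by (cases "length (snd x) = m"; cases "length (fst x) = n") (auto simp: signed_def)
  qed
  have "semidirect.derived (even m) (even n) (lift_cochain F) (lift_cochain G) w
    = (signed (odd m) (signed (odd m) (boundary_insertion F G ?w)
        - signed (odd m) (signed (odd (m * n)) (boundary_insertion G F ?w)))
      - signed (odd m) (signed (even m) (bulk_insertion F G ?w))
      - signed (odd m) (signed (odd m \<and> even n) (bulk_insertion G F ?w)), 0)"
    unfolding semidirect.derived_def semidirect.commutator_def
    by (cases "even m"; cases "even n")
      (simp_all add: circ_add_left semidirect.prod_diff_left circ_minus_left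
        semidirect.prod_add_right[OF lift_in_semidirect_cochains[OF G n]]
        semidirect.prod_diff_right[OF lift_in_semidirect_cochains[OF G n]]
        circ_circ_mult_lift_lift[OF F m] circ_circ_lift_mult_lift[OF F]
        circ_lift_circ_mult_lift[OF G] circ_lift_circ_lift_mult[OF G]
        bd lift_cochain_def sum_negf)
  then show "lift_cochain (bracket lact ract F G) w
    = semidirect.derived (even m) (even n) (lift_cochain F) (lift_cochain G) w"
    unfolding lift_cochain_def[of "bracket lact ract F G"] bracket_def
      letters.insertion_twisted_homogeneous[OF G' n m] insertion_eq
    by (cases "even m"; cases "even n") simp_all
qed

text \<open>
  This is the Jacobi identity of the derived bracket for the lifted cochains, evaluated at the words
  \<open>map (Pair 0) w\<close>, on which a lifted cochain has the values of the original map.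
\<close>

lemma bracket_jacobi:
  assumes F: "multilinear_map scaleM scaleA F" "of_degree m F"
    and G: "multilinear_map scaleM scaleA G" "of_degree n G"
    and K: "multilinear_map scaleM scaleA K" "of_degree k K"
  shows "bracket lact ract F (bracket lact ract G K) w
    = bracket lact ract (bracket lact ract F G) K w
      + signed (odd (m * n)) (bracket lact ract G (bracket lact ract F K) w)"
proof -
  let ?b = "bracket lact ract"
  have ml: "multilinear_map scaleM scaleA (?b F G)"
    if "multilinear_map scaleM scaleA F" "multilinear_map scaleM scaleA G" for F G
  proof -
    interpret F: multilinear_map scaleM scaleA F by fact
    interpret G: multilinear_map scaleM scaleA G by fact
    show ?thesis
      using letters.multilinear_bracket[OF F.multilinear G.multilinear] by unfold_locales
  qed
  have deg: "of_degree (m + n) (?b F G)"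
    if "multilinear_map scaleM scaleA F" "of_degree m F"
      "multilinear_map scaleM scaleA G" "of_degree n G" for F G m n
    using letters.bracket_of_degree that
    by (auto simp: multilinear_map_def multilinear_map_axioms_def)
  let ?l = lift_cochain and ?w = "map (Pair 0) w"
  note H = lift_in_semidirect_cochains
  have "?l (?b F (?b G K)) = ?l (?b (?b F G) K)
      + signed (odd (m * n)) (?l (?b G (?b F K)))"
    using semidirect.derived_jacobi[OF H[OF F] H[OF G] H[OF K]]
      lift_bracket[OF F G] lift_bracket[OF G K] lift_bracket[OF F K]
      lift_bracket[OF F ml[OF G(1) K(1)] deg[OF G K]]
      lift_bracket[OF ml[OF F(1) G(1)] deg[OF F G] K]
      lift_bracket[OF G ml[OF F(1) K(1)] deg[OF F K]]
    by simp
  then have "fst (?l (?b F (?b G K)) ?w) = fst (?l (?b (?b F G) K) ?w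
      + signed (odd (m * n)) (?l (?b G (?b F K)) ?w))"
    by (simp add: signed_def)
  then show ?thesis
    by (simp add: lift_cochain_def signed_def comp_def)
qed

end

section \<open>Labels\<close>

context bimodule
begin

text \<open>
  The type \<open>'x \<Rightarrow>\<^sub>0 'm\<close> is the direct sum of copies of the module \<open>'m\<close> indexed by the labels.
\<close>

definition label_scale :: "'k \<Rightarrow> ('x \<Rightarrow>\<^sub>0 'm) \<Rightarrow> ('x \<Rightarrow>\<^sub>0 'm)"
  where "label_scale c = Poly_Mapping.map (scaleM c)"

definition label_lact :: "'a \<Rightarrow> ('x \<Rightarrow>\<^sub>0 'm) \<Rightarrow> ('x \<Rightarrow>\<^sub>0 'm)"
  where "label_lact a = Poly_Mapping.map (lact a)"

definition label_ract :: "('x \<Rightarrow>\<^sub>0 'm) \<Rightarrow> 'a \<Rightarrow> ('x \<Rightarrow>\<^sub>0 'm)"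
  where "label_ract v a = Poly_Mapping.map (\<lambda>u. ract u a) v"

lemma lookup_label [simp]:
  "Poly_Mapping.lookup (label_scale c v) x = scaleM c (Poly_Mapping.lookup v x)"
  "Poly_Mapping.lookup (label_lact a v) x = lact a (Poly_Mapping.lookup v x)"
  "Poly_Mapping.lookup (label_ract v a) x = ract (Poly_Mapping.lookup v x) a"
  by (simp_all add: label_scale_def label_lact_def label_ract_def Poly_Mapping.map.rep_eq when_def)

lemma label_scale_module: "module (label_scale :: 'k \<Rightarrow> ('x \<Rightarrow>\<^sub>0 'm) \<Rightarrow> _)"
  by standard (auto intro!: poly_mapping_eqI simp: lookup_add vec.scale_right_distrib
      vec.scale_left_distrib)

lemma labelled_bimodule:
  "bimodule scaleA (label_scale :: 'k \<Rightarrow> ('x \<Rightarrow>\<^sub>0 'm) \<Rightarrow> _) label_lact label_ract"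
proof -
  interpret L: module "label_scale :: 'k \<Rightarrow> ('x \<Rightarrow>\<^sub>0 'm) \<Rightarrow> _" by (rule label_scale_module)
  show ?thesis
    by unfold_locales
      (auto intro!: poly_mapping_eqI simp: lookup_add lact_assoc lact_ract ract_assoc)
qed

text \<open>
  The multilinear extension of a family of maps, given as a function of labelled vectors, to the
  direct sum.
\<close>

fun extend :: "(('x \<times> 'm) list \<Rightarrow> 'a) \<Rightarrow> ('x \<Rightarrow>\<^sub>0 'm) list \<Rightarrow> 'a" where
  "extend F [] = F []"
| "extend F (v # vs) = (\<Sum>x\<in>Poly_Mapping.keys v. extend (\<lambda>ys. F ((x, Poly_Mapping.lookup v x) # ys)) vs)"

definition labelled_comb :: "'k \<Rightarrow> 'x \<times> 'm \<Rightarrow> 'x \<times> 'm \<Rightarrow> 'x \<times> 'm \<Rightarrow> bool"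
  where "labelled_comb c y y' z \<longleftrightarrow>
    fst y = fst z \<and> fst y' = fst z \<and> snd z = scaleM c (snd y) + snd y'"

abbreviation labelled_lact :: "'a \<Rightarrow> 'x \<times> 'm \<Rightarrow> 'x \<times> 'm"
  where "labelled_lact a \<equiv> apsnd (lact a)"

abbreviation labelled_ract :: "'x \<times> 'm \<Rightarrow> 'a \<Rightarrow> 'x \<times> 'm"
  where "labelled_ract y a \<equiv> apsnd (\<lambda>u. ract u a) y"

sublocale labelled: letter_bimodule scaleA labelled_comb labelled_lact labelled_ract
  by standard (auto simp: labelled_comb_def)

lemma extend_linear:
  "extend (\<lambda>ys. scaleA c (F ys) + G ys) vs = scaleA c (extend F vs) + extend G vs"
  by (induction vs arbitrary: F G) (simp_all add: sum.distrib alg.scale_sum_right)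

lemma extend_zero: "extend (\<lambda>ys. 0) vs = 0"
  by (induction vs) simp_all

lemma labelled_comb_zero: "multilinear labelled_comb scaleA F \<Longrightarrow> F (p @ (x, 0) # s) = 0"
  using multilinearD[of labelled_comb scaleA F 1 "(x, 0)" "(x, 0)" "(x, 0)" p s]
  by (simp add: labelled_comb_def)

lemma multilinear_extend:
  assumes "multilinear labelled_comb scaleA F"
  shows "multilinear_map label_scale scaleA (extend F)"
proof -
  have "extend F (p @ (label_scale c u + v) # s)
    = scaleA c (extend F (p @ u # s)) + extend F (p @ v # s)" for p s c u v
    using assms
  proof (induction p arbitrary: F)
    case Nil
    let ?w = "label_scale c u + v"
    \<comment> \<open>A common set of labels for the three sums: by multilinearity a label outside of the support of
      a letter contributes nothing.\<close>
    define K where "K = Poly_Mapping.keys ?w \<union> Poly_Mapping.keys u \<union> Poly_Mapping.keys v"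
    have K: "extend F (z # s) = (\<Sum>x\<in>K. extend (\<lambda>ys. F ((x, Poly_Mapping.lookup z x) # ys)) s)"
      if "Poly_Mapping.keys z \<subseteq> K" for z
      using that labelled_comb_zero[OF Nil, of "[]"] extend_zero
      by (auto intro!: sum.mono_neutral_left simp: in_keys_iff K_def)
    have sub: "Poly_Mapping.keys ?w \<subseteq> K" "Poly_Mapping.keys u \<subseteq> K" "Poly_Mapping.keys v \<subseteq> K"
      by (auto simp: K_def)
    have "extend (\<lambda>ys. F ((x, Poly_Mapping.lookup ?w x) # ys)) s
      = scaleA c (extend (\<lambda>ys. F ((x, Poly_Mapping.lookup u x) # ys)) s)
        + extend (\<lambda>ys. F ((x, Poly_Mapping.lookup v x) # ys)) s" for x
      using multilinearD[OF Nil, of c "(x, Poly_Mapping.lookup u x)" "(x, Poly_Mapping.lookup v x)"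
          "(x, Poly_Mapping.lookup ?w x)" "[]"]
      by (simp add: labelled_comb_def lookup_add extend_linear)
    then show ?case
      unfolding append_Nil K[OF sub(1)] K[OF sub(2)] K[OF sub(3)]
      by (simp add: sum.distrib alg.scale_sum_right)
  next
    case (Cons y p)
    have "multilinear labelled_comb scaleA (\<lambda>ys. F (z # ys))" for z
      using Cons.prems unfolding multilinear_def by (metis append_Cons)
    from Cons.IH[OF this] show ?case
      by (simp add: sum.distrib alg.scale_sum_right)
  qed
  then show ?thesis
    using label_scale_module
    by (auto intro!: multilinear_map.intro multilinear_map_axioms.intro alg.module_axioms
        simp: multilinear_def lincomb_def)
qed

lemma extend_of_degree: "of_degree m F \<Longrightarrow> of_degree m (extend F)"
proof -
  assume "of_degree m F"
  have "extend F vs = 0" if "\<And>ys. length ys = length vs \<Longrightarrow> F ys = 0" for vs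
    using that
  proof (induction vs arbitrary: F)
    case (Cons v vs)
    have "extend (\<lambda>ys. F (z # ys)) vs = 0" for z
      by (rule Cons.IH) (simp add: Cons.prems)
    then show ?case by simp
  qed simp
  then show ?thesis using \<open>of_degree m F\<close> unfolding of_degree_def by metis
qed

lemma extend_single:
  assumes "multilinear labelled_comb scaleA F"
  shows "extend F (map (\<lambda>y. Poly_Mapping.single (fst y) (snd y)) ys) = F ys"
  using assms
proof (induction ys arbitrary: F)
  case (Cons y ys)
  have "multilinear labelled_comb scaleA (\<lambda>ys. F (z # ys))" for z
    using Cons.prems unfolding multilinear_def by (metis append_Cons)
  from Cons.IH[OF this] show ?case
    using labelled_comb_zero[OF Cons.prems, of "[]" "fst y" ys]
    by (cases y) auto
qed simp

text \<open>
  Restriction to words of vectors supported at one label commutes with the bracket and inverts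
  the multilinear extension.
\<close>

lemma labelled_bracket_jacobi:
  assumes F: "multilinear labelled_comb scaleA F" "of_degree m F"
    and G: "multilinear labelled_comb scaleA G" "of_degree n G"
    and K: "multilinear labelled_comb scaleA K" "of_degree k K"
  defines "b \<equiv> bracket labelled_lact labelled_ract"
  shows "b F (b G K) w = b (b F G) K w + signed (odd (m * n)) (b G (b F K) w)"
proof -
  interpret N: bimodule scaleA label_scale label_lact label_ract by (rule labelled_bimodule)
  let ?h = "\<lambda>y. Poly_Mapping.single (fst y) (snd y)"
  have "label_lact a (?h y) = ?h (labelled_lact a y)" "label_ract (?h y) a = ?h (labelled_ract y a)"
    for a y
    by (auto intro!: poly_mapping_eqI simp: lookup_single when_def)
  note B = bracket_map[of label_lact ?h labelled_lact label_ract labelled_ract, OF this]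
  note E = multilinear_extend extend_of_degree
  show ?thesis
    using N.bracket_jacobi[OF E(1)[OF F(1)] E(2)[OF F(2)] E(1)[OF G(1)] E(2)[OF G(2)]
        E(1)[OF K(1)] E(2)[OF K(2)], of "map ?h w"]
    unfolding b_def B extend_single[OF F(1)] extend_single[OF G(1)] extend_single[OF K(1)] .
qed

end

section \<open>Families of linear maps on tensor powers\<close>

context bimodule
begin

text \<open>
  The difference of the two sides is the sum of an additivity and a homogeneity relation.
\<close>

lemma tensor_hom_slot:
  assumes h: "h \<in> tensor_hom scaleM scaleA n" and n: "length p + length s + 1 = n"
  shows "h (pure_tensor scaleM (p @ (scaleM c u + v) # s))
    = scaleA c (h (pure_tensor scaleM (p @ u # s))) + h (pure_tensor scaleM (p @ v # s))"
proof -
  let ?e = "\<lambda>x. Poly_Mapping.single (p @ x # s) (1::'k)"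
  let ?us = "p @ u # s"
  have upd: "p @ x # s = ?us[length p := x]" for x by simp
  have fp: "?e x \<in> free_power n" for x using n by (simp add: free_power_def)
  have fps: "free_scale c (?e u) \<in> free_power n" "free_scale c (?e u) + ?e v \<in> free_power n"
    using free_module.subspace_scale[OF subspace_free_power fp, of c u]
      free_module.subspace_add[OF subspace_free_power _ fp] by blast+
  have "?e (scaleM c u + v) - ?e (scaleM c u) - ?e v \<in> multilinearity_relations scaleM n"
    unfolding multilinearity_relations_def using n
    by (intro UnI1 CollectI exI[of _ ?us] exI[of _ "length p"] exI[of _ "scaleM c u"] exI[of _ v])
      simp
  moreover have "?e (scaleM c u) - free_scale c (?e u) \<in> multilinearity_relations scaleM n"
    unfolding multilinearity_relations_def using n
    by (intro UnI2 CollectI exI[of _ ?us] exI[of _ "length p"] exI[of _ c] exI[of _ u]) simp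
  ultimately have "(?e (scaleM c u + v) - ?e (scaleM c u) - ?e v) + (?e (scaleM c u) - free_scale c (?e u))
      \<in> free_module.span (multilinearity_relations scaleM n)"
    by (intro free_module.span_add free_module.span_base)
  then have "?e (scaleM c u + v) - (free_scale c (?e u) + ?e v)
      \<in> free_module.span (multilinearity_relations scaleM n)"
    by (simp add: algebra_simps)
  then have "tensor_class scaleM n (?e (scaleM c u + v))
      = tensor_class scaleM n (free_scale c (?e u) + ?e v)"
    using tensor_class_eq_iff[OF fp fps(2)] by blast
  then have "h (tensor_class scaleM n (?e (scaleM c u + v)))
      = scaleA c (h (tensor_class scaleM n (?e u))) + h (tensor_class scaleM n (?e v))"
    using h fp fps by (simp add: tensor_hom_def)
  then show ?thesis using n by (simp add: pure_tensor_def)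
qed

lemma zero_in_tensor_hom: "0 \<in> tensor_hom scaleM scaleA n"
  by (simp add: tensor_hom_def)

lemma tensor_hom_eqI:
  assumes h: "h \<in> tensor_hom scaleM scaleA n" and h': "h' \<in> tensor_hom scaleM scaleA n"
    and eq: "\<And>us. length us = n \<Longrightarrow> h (pure_tensor scaleM us) = h' (pure_tensor scaleM us)"
  shows "h = h'"
proof -
  let ?f = "\<lambda>us. h (pure_tensor scaleM us)"
  have "\<exists>!h. h \<in> tensor_hom scaleM scaleA n \<and> (\<forall>us. length us = n \<longrightarrow> h (pure_tensor scaleM us) = ?f us)"
  proof (rule tensor_hom_universal)
    show "module scaleA" by (rule alg.module_axioms)
    fix us :: "'m list" and i c u v
    assume i: "length us = n" "i < n"
    then have len: "length (take i us) + length (drop (Suc i) us) + 1 = n" by simp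
    show "?f (us[i := u + v]) = ?f (us[i := u]) + ?f (us[i := v])"
      using tensor_hom_slot[OF h len, of 1 u v] i by (simp add: upd_conv_take_nth_drop)
    have "?f (us[i := 0]) = 0"
      using tensor_hom_slot[OF h len, of 1 0 0] i by (simp add: upd_conv_take_nth_drop)
    then show "?f (us[i := scaleM c u]) = scaleA c (?f (us[i := u]))"
      using tensor_hom_slot[OF h len, of c u 0] i by (simp add: upd_conv_take_nth_drop)
  qed
  then show ?thesis using h h' eq by metis
qed

text \<open>
  Families with components in any set of degrees. The direct sum of the graded components is a submodule,
  and the bracket extends to all of them.
\<close>

definition cochains :: "('k, 'm, 'a, 'x) cochain set"
  where "cochains = {X. snd X [] = 0 \<and>
    (\<forall>xs. xs \<noteq> [] \<longrightarrow> snd X xs \<in> tensor_hom scaleM scaleA (length xs))}"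

text \<open>
  A cochain is encoded by its values on words of labelled vectors, where the empty word accounts for the
  component in \<open>A\<close>.
\<close>

definition word_function :: "('k, 'm, 'a, 'x) cochain \<Rightarrow> ('x \<times> 'm) list \<Rightarrow> 'a"
  where "word_function X w = (if w = [] then fst X else ev scaleM (snd X) (map fst w) (map snd w))"

text \<open>
  The inverse encoding. By the universal property the description is unique for multilinear functions.
\<close>

definition of_word_function :: "(('x \<times> 'm) list \<Rightarrow> 'a) \<Rightarrow> ('k, 'm, 'a, 'x) cochain"
  where "of_word_function F = (F [], \<lambda>xs. if xs = [] then 0 else
    THE h. h \<in> tensor_hom scaleM scaleA (length xs) \<and>
      (\<forall>us. length us = length xs \<longrightarrow> h (pure_tensor scaleM us) = F (zip xs us)))"

lemma multilinear_word_function: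
  fixes X :: "('k, 'm, 'a, 'x) cochain"
  assumes "X \<in> cochains"
  shows "multilinear labelled_comb scaleA (word_function X)"
  unfolding multilinear_def
proof (intro allI impI)
  fix p s :: "('x \<times> 'm) list" and c and y z t :: "'x \<times> 'm"
  assume comb: "labelled_comb c y z t"
  have fst: "fst y = fst t" "fst z = fst t" and snd: "snd t = scaleM c (snd y) + snd z"
    using comb unfolding labelled_comb_def by blast+
  have "snd X (map fst p @ fst t # map fst s) \<in> tensor_hom scaleM scaleA (length (map fst p @ fst t # map fst s))"
    using assms unfolding cochains_def by blast
  from tensor_hom_slot[OF this, of "map snd p" "map snd s" c "snd y" "snd z"]
  show "word_function X (p @ t # s)
      = scaleA c (word_function X (p @ y # s)) + word_function X (p @ z # s)"
    by (simp add: fst snd word_function_def ev_def)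
qed

lemma of_word_function:
  assumes F: "multilinear labelled_comb scaleA F"
  shows of_word_function_in_cochains: "of_word_function F \<in> cochains"
    and word_function_of_word_function: "word_function (of_word_function F) = F"
proof -
  let ?h = "snd (of_word_function F)"
  have h: "?h xs \<in> tensor_hom scaleM scaleA (length xs) \<and>
      (\<forall>us. length us = length xs \<longrightarrow> ?h xs (pure_tensor scaleM us) = F (zip xs us))"
    if "xs \<noteq> []" for xs
  proof -
    have "\<exists>!h. h \<in> tensor_hom scaleM scaleA (length xs) \<and>
      (\<forall>us. length us = length xs \<longrightarrow> h (pure_tensor scaleM us) = F (zip xs us))"
    proof (rule tensor_hom_universal)
      show "module scaleA" by (rule alg.module_axioms)
      fix us :: "'m list" and i c u v
      assume i: "length us = length xs" "i < length xs"
      then have zip: "zip xs (us[i := w])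
          = zip (take i xs) (take i us) @ (xs ! i, w) # zip (drop (Suc i) xs) (drop (Suc i) us)" for w
        by (subst id_take_nth_drop[of i xs]) (simp_all add: upd_conv_take_nth_drop)
      show "F (zip xs (us[i := u + v])) = F (zip xs (us[i := u])) + F (zip xs (us[i := v]))"
        unfolding zip using multilinearD[OF F, of 1 "(xs ! i, u)" "(xs ! i, v)" "(xs ! i, u + v)"]
        by (simp add: labelled_comb_def)
      show "F (zip xs (us[i := scaleM c u])) = scaleA c (F (zip xs (us[i := u])))"
        unfolding zip using multilinearD[OF F, of c "(xs ! i, u)" "(xs ! i, 0)" "(xs ! i, scaleM c u)"]
        by (simp add: labelled_comb_def labelled_comb_zero[OF F])
    qed
    from theI'[OF this] that show ?thesis by (simp add: of_word_function_def)
  qed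
  then show "of_word_function F \<in> cochains"
    by (auto simp: cochains_def) (simp add: of_word_function_def)
  show "word_function (of_word_function F) = F"
  proof
    fix w
    show "word_function (of_word_function F) w = F w"
    proof (cases "w = []")
      case True
      then show ?thesis by (simp add: word_function_def of_word_function_def)
    next
      case False
      then show ?thesis
        using h[of "map fst w"] by (simp add: word_function_def ev_def zip_map_fst_snd)
    qed
  qed
qed

lemma cochain_eqI:
  assumes X: "X \<in> cochains" and Y: "Y \<in> cochains" and eq: "word_function X = word_function Y"
  shows "X = Y"
proof (rule prod_eqI)
  show "fst X = fst Y"
    using fun_cong[OF eq, of "[]"] by (simp add: word_function_def)
  show "snd X = snd Y"
  proof
    fix xs
    show "snd X xs = snd Y xs"
    proof (cases "xs = []")
      case True
      then show ?thesis using X Y by (simp add: cochains_def)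
    next
      case False
      show ?thesis
      proof (rule tensor_hom_eqI)
        show "snd X xs \<in> tensor_hom scaleM scaleA (length xs)"
          "snd Y xs \<in> tensor_hom scaleM scaleA (length xs)"
          using X Y False by (auto simp: cochains_def)
        show "snd X xs (pure_tensor scaleM us) = snd Y xs (pure_tensor scaleM us)"
          if "length us = length xs" for us
        proof -
          have "us \<noteq> []" using False that by auto
          then show ?thesis
            using fun_cong[OF eq, of "zip xs us"] False that by (simp add: word_function_def ev_def)
        qed
      qed
    qed
  qed
qed

lemma word_function_add: "word_function (X + Y) w = word_function X w + word_function Y w"
  by (simp add: word_function_def ev_def)

lemma word_function_zero [simp]: "word_function 0 w = 0"
  by (simp add: word_function_def ev_def)

lemma word_function_minus: "word_function (- X) w = - word_function X w"
  by (simp add: word_function_def ev_def)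

lemma word_function_scale: "word_function (cochain_scale scaleA c X) w = scaleA c (word_function X w)"
  by (simp add: word_function_def ev_def cochain_scale_def)

lemma word_function_sum: "word_function (\<Sum>i\<in>I. f i) w = (\<Sum>i\<in>I. word_function (f i) w)"
  by (induction I rule: infinite_finite_induct) (simp_all add: word_function_add)

sublocale cochain: module "cochain_scale scaleA :: 'k \<Rightarrow> ('k, 'm, 'a, 'x) cochain \<Rightarrow> _"
  by standard (auto simp: cochain_scale_def alg.scale_right_distrib alg.scale_left_distrib
      fun_eq_iff)

lemma cochain_scale_minus_one_power:
  "cochain_scale scaleA ((- 1) ^ k) X = signed (odd k) (X :: ('k, 'm, 'a, 'x) cochain)"
  by (cases "even k") simp_all

lemma scaleA_minus_one_power: "scaleA ((- 1) ^ k) a = signed (odd k) a"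
  by (cases "even k") simp_all

lemma subspace_cochains: "cochain.subspace (cochains :: ('k, 'm, 'a, 'x) cochain set)"
proof -
  have "h + h' \<in> tensor_hom scaleM scaleA n" "(\<lambda>t. scaleA c (h t)) \<in> tensor_hom scaleM scaleA n"
    if "h \<in> tensor_hom scaleM scaleA n" "h' \<in> tensor_hom scaleM scaleA n" for h h' c n
    using that by (auto simp: tensor_hom_def alg.scale_right_distrib algebra_simps)
  then show ?thesis
    unfolding cochain.subspace_def
    by (auto simp: cochains_def cochain_scale_def zero_in_tensor_hom)
qed

lemma graded_component_iff:
  "X \<in> graded_component scaleM scaleA n \<longleftrightarrow> X \<in> cochains \<and> of_degree n (word_function X)"
  (is "?L \<longleftrightarrow> ?R")
proof
  assume L: ?L
  show ?R
  proof (cases "n = 0")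
    case True
    with L have "snd X = 0" by (auto simp: graded_component_def)
    with True show ?thesis
      by (auto simp: cochains_def zero_in_tensor_hom of_degree_def word_function_def ev_def
          split: if_splits)
  next
    case False
    with L have X: "fst X = 0" "snd X \<in> family_space scaleM scaleA n"
      by (auto simp: graded_component_def)
    then have "snd X xs = 0" if "length xs \<noteq> n" for xs
      using that by (auto simp: family_space_def)
    moreover have "snd X xs \<in> tensor_hom scaleM scaleA n" if "length xs = n" for xs
      using X(2) that unfolding family_space_def by auto
    ultimately have "snd X xs \<in> tensor_hom scaleM scaleA (length xs)" for xs
      using zero_in_tensor_hom by (cases "length xs = n") auto
    with \<open>\<And>xs. length xs \<noteq> n \<Longrightarrow> snd X xs = 0\<close> False X(1) show ?thesis
      by (auto simp: cochains_def of_degree_def word_function_def ev_def split: if_splits)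
        (metis length_map zero_fun_apply)
  qed
next
  assume R: ?R
  then have X: "X \<in> cochains" and deg: "of_degree n (word_function X)" by auto
  have nonempty: "snd X xs = 0" if "xs \<noteq> []" "length xs \<noteq> n" for xs
  proof (rule tensor_hom_eqI)
    show "snd X xs \<in> tensor_hom scaleM scaleA (length xs)"
      using X that by (simp add: cochains_def)
    show "0 \<in> tensor_hom scaleM scaleA (length xs)" by (rule zero_in_tensor_hom)
    show "snd X xs (pure_tensor scaleM us) = 0 (pure_tensor scaleM us)" if "length us = length xs" for us
      using of_degreeD[OF deg, of "zip xs us"] that \<open>xs \<noteq> []\<close> \<open>length xs \<noteq> n\<close>
      by (auto simp: word_function_def ev_def split: if_splits)
  qed
  have "snd X [] = 0" using X by (simp add: cochains_def)
  then have zero: "snd X xs = 0" if "length xs \<noteq> n \<or> xs = []" for xs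
    using that nonempty[of xs] by (cases "xs = []") simp_all
  show ?L
  proof (cases "n = 0")
    case True
    then have "snd X = 0" using zero by (auto simp: fun_eq_iff)
    with True show ?thesis by (cases X) (simp add: graded_component_def)
  next
    case False
    then have "fst X = 0" using of_degreeD[OF deg, of "[]"] by (simp add: word_function_def)
    moreover have "snd X xs \<in> tensor_hom scaleM scaleA n" if "length xs = n" for xs
      using X that False by (auto simp: cochains_def)
    ultimately show ?thesis
      using False zero by (cases X) (auto simp: graded_component_def family_space_def)
  qed
qed

definition cochain_bracket ::
    "('k, 'm, 'a, 'x) cochain \<Rightarrow> ('k, 'm, 'a, 'x) cochain \<Rightarrow> ('k, 'm, 'a, 'x) cochain"
  where "cochain_bracket X Y
    = of_word_function (bracket labelled_lact labelled_ract (word_function X) (word_function Y))"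

lemma cochain_bracket:
  assumes "X \<in> cochains" "Y \<in> cochains"
  shows cochain_bracket_in_cochains: "cochain_bracket X Y \<in> cochains"
    and word_function_cochain_bracket: "word_function (cochain_bracket X Y)
      = bracket labelled_lact labelled_ract (word_function X) (word_function Y)"
  unfolding cochain_bracket_def
  using of_word_function[OF labelled.multilinear_bracket[OF
        multilinear_word_function[OF assms(1)] multilinear_word_function[OF assms(2)]]] .

text \<open>
  Cochains are determined by their word functions, so every law is checked on word functions, where it
  is a law of the bracket on labelled words.
\<close>

lemma graded_lie_algebra_cochain_bracket:
  "graded_lie_algebra (cochain_scale scaleA)
    (graded_component scaleM scaleA :: nat \<Rightarrow> ('k, 'm, 'a, 'x) cochain set) cochain_bracket"
proof -
  let ?g = "graded_component scaleM scaleA :: nat \<Rightarrow> ('k, 'm, 'a, 'x) cochain set"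
  have "(\<Union>n. ?g n) \<subseteq> cochains"
    using graded_component_iff by blast
  from cochain.span_minimal[OF this subspace_cochains]
  have span: "X \<in> cochains" if "X \<in> cochain.span (\<Union>n. ?g n)" for X :: "('k, 'm, 'a, 'x) cochain"
    using that by blast
  note add = cochain.subspace_add[OF subspace_cochains] and scale = cochain.subspace_scale[OF subspace_cochains]
    and neg = cochain.subspace_neg[OF subspace_cochains]
  have signed: "signed e X \<in> cochains" if "X \<in> cochains" for e and X :: "('k, 'm, 'a, 'x) cochain"
    using that neg[OF that] by (cases e) simp_all
  have wf_signed: "word_function (signed e X) w = signed e (word_function X w)"
    for e w and X :: "('k, 'm, 'a, 'x) cochain"
    by (cases e) (simp_all add: word_function_minus)
  note ml = multilinear_word_function
  have wf_add: "word_function (X + Y) = (\<lambda>w. scaleA 1 (word_function X w) + word_function Y w)"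
    for X Y :: "('k, 'm, 'a, 'x) cochain"
    by (simp add: fun_eq_iff word_function_add)
  have wf_scale: "word_function (cochain_scale scaleA c X) = (\<lambda>w. scaleA c (word_function X w) + word_function 0 w)"
    for c and X :: "('k, 'm, 'a, 'x) cochain"
    by (simp add: fun_eq_iff word_function_scale)
  have degI: "of_degree n F" if "\<And>w. length w \<noteq> n \<Longrightarrow> F w = 0" for n and F :: "('x \<times> 'm) list \<Rightarrow> 'a"
    using that unfolding of_degree_def by blast
  have br0: "bracket labelled_lact labelled_ract F (\<lambda>w. 0) w = 0"
    "bracket labelled_lact labelled_ract (\<lambda>w. 0) F w = 0"
    if "multilinear labelled_comb scaleA F" for F w
    using labelled.bracket_linear_right[OF that, of 1 "\<lambda>w. 0" "\<lambda>w. 0" w]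
      labelled.bracket_linear_left[OF that, of 1 "\<lambda>w. 0" "\<lambda>w. 0" w] by simp_all
  show ?thesis
  proof
    fix n m p :: nat and x y z :: "('k, 'm, 'a, 'x) cochain" and c
    show "cochain.subspace (?g n)"
    proof (rule cochain.subspaceI)
      show "0 \<in> ?g n"
        using cochain.subspace_0[OF subspace_cochains] by (auto simp: graded_component_iff intro: degI)
      show "X + Y \<in> ?g n" if "X \<in> ?g n" "Y \<in> ?g n" for X Y
        using that by (auto simp: graded_component_iff word_function_add of_degreeD intro: add degI)
      show "cochain_scale scaleA c X \<in> ?g n" if "X \<in> ?g n" for c X
        using that by (auto simp: graded_component_iff word_function_scale of_degreeD intro: scale degI)
    qed
    show "cochain_bracket (x + y) z = cochain_bracket x z + cochain_bracket y z"
      if "x \<in> cochain.span (\<Union>n. ?g n)" "y \<in> cochain.span (\<Union>n. ?g n)" "z \<in> cochain.span (\<Union>n. ?g n)"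
    proof (rule cochain_eqI)
      note C = that[THEN span]
      show "cochain_bracket (x + y) z \<in> cochains" "cochain_bracket x z + cochain_bracket y z \<in> cochains"
        using C by (auto intro!: cochain_bracket_in_cochains add)
      show "word_function (cochain_bracket (x + y) z) = word_function (cochain_bracket x z + cochain_bracket y z)"
        using labelled.bracket_linear_left[OF ml[OF C(3)], of 1 "word_function x" "word_function y"] C
        by (simp add: fun_eq_iff word_function_add word_function_cochain_bracket add wf_add[of x y])
    qed
    show "cochain_bracket x (y + z) = cochain_bracket x y + cochain_bracket x z"
      if "x \<in> cochain.span (\<Union>n. ?g n)" "y \<in> cochain.span (\<Union>n. ?g n)" "z \<in> cochain.span (\<Union>n. ?g n)"
    proof (rule cochain_eqI)
      note C = that[THEN span]
      show "cochain_bracket x (y + z) \<in> cochains" "cochain_bracket x y + cochain_bracket x z \<in> cochains"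
        using C by (auto intro!: cochain_bracket_in_cochains add)
      show "word_function (cochain_bracket x (y + z)) = word_function (cochain_bracket x y + cochain_bracket x z)"
        using labelled.bracket_linear_right[OF ml[OF C(1)], of 1 "word_function y" "word_function z"] C
        by (simp add: fun_eq_iff word_function_add word_function_cochain_bracket add wf_add[of y z])
    qed
    show "cochain_bracket (cochain_scale scaleA c x) y = cochain_scale scaleA c (cochain_bracket x y)"
      if "x \<in> cochain.span (\<Union>n. ?g n)" "y \<in> cochain.span (\<Union>n. ?g n)"
    proof (rule cochain_eqI)
      note C = that[THEN span]
      show "cochain_bracket (cochain_scale scaleA c x) y \<in> cochains"
        "cochain_scale scaleA c (cochain_bracket x y) \<in> cochains"
        using C by (auto intro!: cochain_bracket_in_cochains scale)
      show "word_function (cochain_bracket (cochain_scale scaleA c x) y)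
          = word_function (cochain_scale scaleA c (cochain_bracket x y))"
        using labelled.bracket_linear_left[OF ml[OF C(2)], of c "word_function x" "\<lambda>w. 0"] C
        by (simp add: fun_eq_iff word_function_scale[of c "cochain_bracket x y"]
            word_function_cochain_bracket scale wf_scale br0 ml)
    qed
    show "cochain_bracket x (cochain_scale scaleA c y) = cochain_scale scaleA c (cochain_bracket x y)"
      if "x \<in> cochain.span (\<Union>n. ?g n)" "y \<in> cochain.span (\<Union>n. ?g n)"
    proof (rule cochain_eqI)
      note C = that[THEN span]
      show "cochain_bracket x (cochain_scale scaleA c y) \<in> cochains"
        "cochain_scale scaleA c (cochain_bracket x y) \<in> cochains"
        using C by (auto intro!: cochain_bracket_in_cochains scale)
      show "word_function (cochain_bracket x (cochain_scale scaleA c y))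
          = word_function (cochain_scale scaleA c (cochain_bracket x y))"
        using labelled.bracket_linear_right[OF ml[OF C(1)], of c "word_function y" "\<lambda>w. 0"] C
        by (simp add: fun_eq_iff word_function_scale[of c "cochain_bracket x y"]
            word_function_cochain_bracket scale wf_scale br0 ml)
    qed
    show "cochain_bracket x y \<in> ?g (m + n)" if "x \<in> ?g m" "y \<in> ?g n"
      using that labelled.bracket_of_degree[of "word_function x" m "word_function y" n]
      by (simp add: graded_component_iff cochain_bracket ml)
    show "cochain_bracket x y = - cochain_scale scaleA ((- 1) ^ (m * n)) (cochain_bracket y x)"
      if "x \<in> ?g m" "y \<in> ?g n"
    proof (rule cochain_eqI)
      have C: "x \<in> cochains" "y \<in> cochains" "of_degree m (word_function x)" "of_degree n (word_function y)"
        using that by (auto simp: graded_component_iff)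
      show "cochain_bracket x y \<in> cochains"
        "- cochain_scale scaleA ((- 1) ^ (m * n)) (cochain_bracket y x) \<in> cochains"
        using C by (auto intro!: cochain_bracket_in_cochains scale neg)
      show "word_function (cochain_bracket x y)
          = word_function (- cochain_scale scaleA ((- 1) ^ (m * n)) (cochain_bracket y x))"
        using labelled.bracket_skew_symmetric[OF ml[OF C(1)] C(3) ml[OF C(2)] C(4)] C
        by (simp add: fun_eq_iff word_function_minus cochain_scale_minus_one_power wf_signed
            word_function_cochain_bracket)
    qed
    show "cochain_bracket x (cochain_bracket y z) = cochain_bracket (cochain_bracket x y) z
        + cochain_scale scaleA ((- 1) ^ (m * n)) (cochain_bracket y (cochain_bracket x z))"
      if "x \<in> ?g m" "y \<in> ?g n" "z \<in> ?g p"
    proof (rule cochain_eqI)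
      have C: "x \<in> cochains" "y \<in> cochains" "z \<in> cochains" "of_degree m (word_function x)"
        "of_degree n (word_function y)" "of_degree p (word_function z)"
        using that by (auto simp: graded_component_iff)
      show "cochain_bracket x (cochain_bracket y z) \<in> cochains"
        "cochain_bracket (cochain_bracket x y) z
        + cochain_scale scaleA ((- 1) ^ (m * n)) (cochain_bracket y (cochain_bracket x z)) \<in> cochains"
        using C by (auto intro!: cochain_bracket_in_cochains scale add)
      show "word_function (cochain_bracket x (cochain_bracket y z)) = word_function (cochain_bracket (cochain_bracket x y) z
        + cochain_scale scaleA ((- 1) ^ (m * n)) (cochain_bracket y (cochain_bracket x z)))"
        using labelled_bracket_jacobi[OF ml[OF C(1)] C(4) ml[OF C(2)] C(5) ml[OF C(3)] C(6)] C(1-3)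
        by (simp add: fun_eq_iff word_function_add cochain_scale_minus_one_power wf_signed cochain_bracket)
    qed
  next
    fix N :: "nat set" and f :: "nat \<Rightarrow> ('k, 'm, 'a, 'x) cochain" and n
    assume N: "finite N" "n \<in> N" and f: "\<And>n. n \<in> N \<Longrightarrow> f n \<in> ?g n" and sum: "(\<Sum>n\<in>N. f n) = 0"
    have deg: "of_degree k (word_function (f k))" "f k \<in> cochains" if "k \<in> N" for k
      using f[OF that] by (simp_all add: graded_component_iff)
    show "f n = 0"
    proof (rule cochain_eqI)
      show "f n \<in> cochains" using deg N by blast
      show "0 \<in> cochains" using cochain.subspace_0[OF subspace_cochains] .
      show "word_function (f n) = word_function 0"
      proof
        fix w
        show "word_function (f n) w = word_function 0 w"
        proof (cases "length w = n")
          case True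
          have "0 = word_function (\<Sum>k\<in>N. f k) w" by (simp add: sum)
          also have "\<dots> = (\<Sum>k\<in>N. word_function (f k) w)" by (rule word_function_sum)
          also have "\<dots> = word_function (f n) w"
            using N True by (intro sum_eq_single) (auto intro: of_degreeD[OF deg(1)])
          finally show ?thesis by simp
        next
          case False
          then show ?thesis using of_degreeD[OF deg(1)[OF N(2)]] by simp
        qed
      qed
    qed
  qed
qed

end

section \<open>The bracket in terms of indices\<close>

lemma seg_append: "i \<le> Suc j \<Longrightarrow> j \<le> k \<Longrightarrow> seg y i j @ seg y (j + 1) k = seg y i k"
  using upt_add_eq_append[of i "Suc j" "k - j"]
  by (simp add: seg_def map_append[symmetric] del: upt_Suc map_append)

text \<open>
  If the middle block has the prescribed length \<open>n\<close>, a factorisation is determined by the length \<open>k\<close> of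
  its left block.
\<close>

lemma sum_splits_seg:
  fixes T :: "'y list \<Rightarrow> 'y list \<Rightarrow> 'y list \<Rightarrow> 'b::comm_monoid_add"
  assumes zero: "\<And>p q s. length q \<noteq> n \<Longrightarrow> T p q s = 0"
  shows "(\<Sum>(p, q, s)\<in>splits (seg y 1 (m + n)). T p q s)
    = (\<Sum>k\<le>m. T (seg y 1 k) (seg y (k + 1) (k + n)) (seg y (k + n + 1) (m + n)))"
proof -
  let ?w = "seg y 1 (m + n)"
  have "(\<Sum>(p, q, s)\<in>splits ?w. T p q s) = (\<Sum>(p, q, s)\<in>{(p, q, s) \<in> splits ?w. length q = n}. T p q s)"
    using zero by (intro sum.mono_neutral_right) auto
  also have "\<dots> = (\<Sum>k\<le>m. T (seg y 1 k) (seg y (k + 1) (k + n)) (seg y (k + n + 1) (m + n)))"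
  proof (rule sum.reindex_bij_witness[where j = "\<lambda>(p, q, s). length p" and
        i = "\<lambda>k. (seg y 1 k, seg y (k + 1) (k + n), seg y (k + n + 1) (m + n))"])
    have seg: "p = seg y 1 (length p) \<and> q = seg y (length p + 1) (length p + n)
        \<and> s = seg y (length p + n + 1) (m + n) \<and> length p \<le> m"
      if "p @ q @ s = ?w" "length q = n" for p q s
    proof -
      have "length p + (length q + length s) = m + n"
        using arg_cong[OF that(1), of length] by (simp add: seg_def del: upt_Suc)
      then have len: "length p + length s = m" using that by simp
      have "take (length p) [1..<Suc (m + n)] = [1..<Suc (length p)]"
        "take n (drop (length p) [1..<Suc (m + n)]) = [length p + 1..<Suc (length p + n)]"
        "drop n (drop (length p) [1..<Suc (m + n)]) = [length p + n + 1..<Suc (m + n)]"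
        using len by (simp_all add: take_upt add_ac del: upt_Suc)
      moreover have "p = take (length p) ?w" "q = take n (drop (length p) ?w)"
        "s = drop n (drop (length p) ?w)"
        unfolding that(1)[symmetric] using that(2) by simp_all
      ultimately show ?thesis
        using len unfolding seg_def take_map drop_map by simp
    qed
    fix a assume a: "a \<in> {(p, q, s) \<in> splits ?w. length q = n}"
    then show "(\<lambda>k. (seg y 1 k, seg y (k + 1) (k + n), seg y (k + n + 1) (m + n)))
        ((\<lambda>(p, q, s). length p) a) = a"
      using seg by (auto simp del: One_nat_def)
    show "(\<lambda>(p, q, s). length p) a \<in> {..m}" using a seg by auto
    show "T (seg y 1 ((\<lambda>(p, q, s). length p) a)) (seg y ((\<lambda>(p, q, s). length p) a + 1) ((\<lambda>(p, q, s). length p) a + n))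
        (seg y ((\<lambda>(p, q, s). length p) a + n + 1) (m + n)) = (case a of (p, q, s) \<Rightarrow> T p q s)"
      using a seg by (auto simp del: One_nat_def)
  next
    fix k assume k: "k \<in> {..m}"
    have "seg y 1 k @ seg y (k + 1) (k + n) @ seg y (k + n + 1) (m + n) = ?w"
      using k by (simp add: seg_append del: One_nat_def)
    then show "(seg y 1 k, seg y (k + 1) (k + n), seg y (k + n + 1) (m + n))
        \<in> {(p, q, s) \<in> splits ?w. length q = n}"
      by (simp add: seg_def del: upt_Suc)
    show "(\<lambda>(p, q, s). length p) (seg y 1 k, seg y (k + 1) (k + n), seg y (k + n + 1) (m + n)) = k"
      by (simp add: seg_def)
  qed
  finally show ?thesis .
qed

lemma seg_Cons: "i \<le> j \<Longrightarrow> seg y i j = y i # seg y (i + 1) j"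
  by (simp add: seg_def upt_rec)

lemma seg_snoc: "i \<le> Suc j \<Longrightarrow> seg y i (Suc j) = seg y i j @ [y (Suc j)]"
  by (simp add: seg_def)

text \<open>
  A left block of length \<open>k\<close> gives the summand \<open>i = k + 1\<close> of the first sum, for \<open>k < m\<close>, and the summand
  \<open>i = k\<close> of the second sum, for \<open>k > 0\<close>. The product of values comes from \<open>k = m\<close>.
\<close>

lemma (in letter_bimodule) insertion_seg:
  assumes F: "multilinear comb scale F" and n: "of_degree n G"
  shows "insertion l r False F G (seg y 1 (m + n))
    = (\<Sum>i = 1..m. signed (odd ((i - 1) * n)) (F (seg y 1 (i - 1)
        @ [l (G (seg y i (i + n - 1))) (y (i + n))] @ seg y (i + n + 1) (m + n))))
    - (\<Sum>i = 1..m. signed (odd (i * n)) (F (seg y 1 (i - 1)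
        @ [r (y i) (G (seg y (i + 1) (i + n)))] @ seg y (i + n + 1) (m + n))))
    + signed (odd (m * n)) (F (seg y 1 m) * G (seg y (m + 1) (m + n)))"
proof -
  have len: "length (seg y i j) = Suc j - i" for i j by (simp add: seg_def del: upt_Suc)
  let ?s = "\<lambda>k. odd (k * n)"
  let ?G = "\<lambda>k. G (seg y (k + 1) (k + n))" and ?r = "\<lambda>k. seg y (k + n + 1) (m + n)"
  have "insertion l r False F G (seg y 1 (m + n))
    = (\<Sum>k\<le>m. signed (odd (length (seg y 1 k) * length (seg y (k + 1) (k + n))) \<noteq>
        (False \<and> odd (length (seg y (k + 1) (k + n)) * (length (seg y 1 k) + length (?r k)))))
       (next_insertion l F (seg y 1 k) (?G k) (?r k) - previous_insertion r F (seg y 1 k) (?G k) (?r k)))"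
    unfolding insertion_def
  proof (rule sum_splits_seg)
    fix p q s :: "'y list" assume "length q \<noteq> n"
    then have "G q = 0" by (rule of_degreeD[OF n])
    then show "signed (odd (length p * length q) \<noteq> (False \<and> odd (length q * (length p + length s))))
        (next_insertion l F p (G q) s - previous_insertion r F p (G q) s) = 0"
      using zero_letter[OF F] zero_letter(1)[OF F, of "[]"]
      by (simp add: next_insertion_def previous_insertion_def)
  qed
  also have "\<dots> = (\<Sum>k\<le>m. signed (?s k) (next_insertion l F (seg y 1 k) (?G k) (?r k)))
    - (\<Sum>k\<le>m. signed (?s k) (previous_insertion r F (seg y 1 k) (?G k) (?r k)))"
    by (simp add: len signed_diff sum_subtractf)
  also have "(\<Sum>k\<le>m. signed (?s k) (next_insertion l F (seg y 1 k) (?G k) (?r k)))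
    = (\<Sum>k<m. signed (?s k) (next_insertion l F (seg y 1 k) (?G k) (?r k)))
      + signed (?s m) (F (seg y 1 m) * ?G m)"
    by (simp add: lessThan_Suc_atMost[symmetric] next_insertion_def seg_def)
  also have "(\<Sum>k<m. signed (?s k) (next_insertion l F (seg y 1 k) (?G k) (?r k)))
    = (\<Sum>k<m. signed (?s k) (F (seg y 1 k @ [l (?G k) (y (k + n + 1))] @ seg y (k + n + 2) (m + n))))"
  proof (intro sum.cong refl)
    fix k assume "k \<in> {..<m}"
    then have "?r k = y (k + n + 1) # seg y (k + n + 2) (m + n)" by (simp add: seg_Cons)
    then show "signed (?s k) (next_insertion l F (seg y 1 k) (?G k) (?r k))
      = signed (?s k) (F (seg y 1 k @ [l (?G k) (y (k + n + 1))] @ seg y (k + n + 2) (m + n)))"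
      by (simp add: next_insertion_def)
  qed
  also have "\<dots> = (\<Sum>i = 1..m. signed (odd ((i - 1) * n)) (F (seg y 1 (i - 1)
        @ [l (G (seg y i (i + n - 1))) (y (i + n))] @ seg y (i + n + 1) (m + n))))"
    by (simp add: sum.atLeast1_atMost_eq)
  also have "(\<Sum>k\<le>m. signed (?s k) (previous_insertion r F (seg y 1 k) (?G k) (?r k)))
    = (\<Sum>i = 1..m. signed (odd (i * n)) (previous_insertion r F (seg y 1 i) (?G i) (?r i)))"
    by (simp add: sum.atLeast1_atMost_eq sum.atMost_shift previous_insertion_def seg_def)
  also have "\<dots> = (\<Sum>i = 1..m. signed (odd (i * n)) (F (seg y 1 (i - 1)
        @ [r (y i) (G (seg y (i + 1) (i + n)))] @ seg y (i + n + 1) (m + n))))"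
  proof (intro sum.cong refl)
    fix i assume "i \<in> {1..m}"
    then obtain j where "i = Suc j" by (cases i) auto
    then show "signed (odd (i * n)) (previous_insertion r F (seg y 1 i) (?G i) (?r i))
      = signed (odd (i * n)) (F (seg y 1 (i - 1)
        @ [r (y i) (G (seg y (i + 1) (i + n)))] @ seg y (i + n + 1) (m + n)))"
      by (simp add: previous_insertion_def seg_snoc)
  qed
  finally show ?thesis by (simp add: algebra_simps)
qed

context bimodule
begin

lemma word_function_fam:
  "w \<noteq> [] \<Longrightarrow> word_function (fam P) w = ev scaleM P (map fst w) (map snd w)"
  by (simp add: word_function_def)

lemma word_function_deg0: "word_function (deg0 a) w = (if w = [] then a else 0)"
  by (simp add: word_function_def ev_def)

lemma family_space_cochain:
  assumes "P \<in> family_space scaleM scaleA m" "m \<ge> 1"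
  shows "fam P \<in> cochains" "of_degree m (word_function (fam P))"
proof -
  have "fam P \<in> graded_component scaleM scaleA m" using assms by (simp add: graded_component_def)
  then show "fam P \<in> cochains" "of_degree m (word_function (fam P))"
    unfolding graded_component_iff by simp_all
qed

lemma algebra_cochain:
  "(deg0 a :: ('k, 'm, 'a, 'x) cochain) \<in> cochains"
  "of_degree 0 (word_function (deg0 a :: ('k, 'm, 'a, 'x) cochain))"
proof -
  have "(deg0 a :: ('k, 'm, 'a, 'x) cochain) \<in> graded_component scaleM scaleA 0"
    by (simp add: graded_component_def)
  then show "(deg0 a :: ('k, 'm, 'a, 'x) cochain) \<in> cochains"
    "of_degree 0 (word_function (deg0 a :: ('k, 'm, 'a, 'x) cochain))"
    unfolding graded_component_iff by simp_all
qed

lemma map_seg: "map f (seg y i j) = seg (\<lambda>k. f (y k)) i j"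
  by (simp add: seg_def)

lemma seg_eq_Nil: "seg y i j = [] \<longleftrightarrow> j < i"
  by (auto simp: seg_def)

lemma insertion_families:
  fixes x :: "nat \<Rightarrow> 'x" and u :: "nat \<Rightarrow> 'm"
  assumes P: "P \<in> family_space scaleM scaleA m" "m \<ge> 1"
    and Q: "Q \<in> family_space scaleM scaleA n" "n \<ge> 1"
  shows "insertion labelled_lact labelled_ract False (word_function (fam P)) (word_function (fam Q))
      (seg (\<lambda>k. (x k, u k)) 1 (m + n))
    = (\<Sum>i = 1..m. scaleA ((- 1) ^ ((i - 1) * n))
          (ev scaleM P (seg x 1 (i - 1) @ seg x (i + n) (m + n))
            (seg u 1 (i - 1)
              @ [lact (ev scaleM Q (seg x i (i + n - 1)) (seg u i (i + n - 1))) (u (i + n))]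
              @ seg u (i + n + 1) (m + n))))
        - (\<Sum>i = 1..m. scaleA ((- 1) ^ (i * n))
          (ev scaleM P (seg x 1 i @ seg x (i + n + 1) (m + n))
            (seg u 1 (i - 1)
              @ [ract (u i) (ev scaleM Q (seg x (i + 1) (i + n)) (seg u (i + 1) (i + n)))]
              @ seg u (i + n + 1) (m + n))))
        + scaleA ((- 1) ^ (m * n))
          (ev scaleM P (seg x 1 m) (seg u 1 m)
              * ev scaleM Q (seg x (m + 1) (m + n)) (seg u (m + 1) (m + n)))"
proof -
  note C = family_space_cochain[OF P] family_space_cochain[OF Q]
  let ?y = "\<lambda>k. (x k, u k)"
  have seg: "word_function (fam R) (seg ?y i j) = ev scaleM R (seg x i j) (seg u i j)" if "i \<le> j" for R i j
    using that by (simp add: word_function_fam seg_eq_Nil map_seg)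
  have left: "word_function (fam P) (seg ?y 1 (i - 1) @ [labelled_lact a (?y (i + n))] @ seg ?y (i + n + 1) (m + n))
    = ev scaleM P (seg x 1 (i - 1) @ seg x (i + n) (m + n))
        (seg u 1 (i - 1) @ [lact a (u (i + n))] @ seg u (i + n + 1) (m + n))" if "i \<in> {1..m}" for a i
    using that seg_Cons[of "i + n" "m + n" x] by (simp add: word_function_fam map_seg)
  have right: "word_function (fam P) (seg ?y 1 (i - 1) @ [labelled_ract (?y i) a] @ seg ?y (i + n + 1) (m + n))
    = ev scaleM P (seg x 1 i @ seg x (i + n + 1) (m + n))
        (seg u 1 (i - 1) @ [ract (u i) a] @ seg u (i + n + 1) (m + n))" if "i \<in> {1..m}" for a i
    using that seg_snoc[of 1 "i - 1" x] by (simp add: word_function_fam map_seg)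
  show ?thesis
    unfolding labelled.insertion_seg[OF multilinear_word_function[OF C(1)] C(4)] scaleA_minus_one_power
    using P(2) Q(2)
    by (intro arg_cong2[where f = "(+)"] arg_cong2[where f = "(-)"] sum.cong refl)
      (simp_all only: left right, simp_all add: seg)
qed

lemma cochain_bracket_families:
  fixes x :: "nat \<Rightarrow> 'x" and u :: "nat \<Rightarrow> 'm"
  assumes P: "P \<in> family_space scaleM scaleA m" "m \<ge> 1"
    and Q: "Q \<in> family_space scaleM scaleA n" "n \<ge> 1"
  defines "y \<equiv> \<lambda>k. (x k, u k)"
  defines "I \<equiv> insertion labelled_lact labelled_ract False"
  shows "ev scaleM (snd (cochain_bracket (fam P) (fam Q))) (seg x 1 (m + n)) (seg u 1 (m + n))
    = I (word_function (fam P)) (word_function (fam Q)) (seg y 1 (m + n))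
      - scaleA ((- 1) ^ (m * n)) (I (word_function (fam Q)) (word_function (fam P)) (seg y 1 (n + m)))"
proof -
  note C = family_space_cochain[OF P] family_space_cochain[OF Q]
  have "ev scaleM (snd (cochain_bracket (fam P) (fam Q))) (seg x 1 (m + n)) (seg u 1 (m + n))
    = word_function (cochain_bracket (fam P) (fam Q)) (seg y 1 (m + n))"
    using P(2) by (simp add: word_function_def seg_eq_Nil map_seg y_def)
  then show ?thesis
    unfolding word_function_cochain_bracket[OF C(1,3)] bracket_def I_def
      labelled.insertion_twisted_homogeneous[OF multilinear_word_function[OF C(3)] C(4,2)]
    by (simp add: scaleA_minus_one_power mult.commute add.commute)
qed

text \<open>
  The element \<open>a\<close> is a map on the empty word, so this is the general index formula with \<open>n = 0\<close>; the two
  sums run over the same slots and are joined by linearity.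
\<close>

lemma cochain_bracket_family_algebra:
  fixes x :: "nat \<Rightarrow> 'x" and u :: "nat \<Rightarrow> 'm"
  assumes P: "P \<in> family_space scaleM scaleA m" "m \<ge> 1"
  shows "ev scaleM (snd (cochain_bracket (fam P) (deg0 a))) (seg x 1 m) (seg u 1 m)
    = (\<Sum>i = 1..m. ev scaleM P (seg x 1 m)
            (seg u 1 (i - 1) @ [lact a (u i) - ract (u i) a] @ seg u (i + 1) m))
          + ev scaleM P (seg x 1 m) (seg u 1 m) * a
          - a * ev scaleM P (seg x 1 m) (seg u 1 m)"
proof -
  note C = family_space_cochain[OF P]
  note D = algebra_cochain[of a, where 'x = 'x]
  note ml = multilinear_word_function
  let ?y = "\<lambda>k. (x k, u k)" and ?F = "word_function (fam P)" and ?G = "word_function (deg0 a) :: ('x \<times> 'm) list \<Rightarrow> 'a"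
  let ?w = "\<lambda>i v. seg ?y 1 (i - 1) @ [(x i, v)] @ seg ?y (i + 1) m"
  have F: "?F (seg ?y 1 m) = ev scaleM P (seg x 1 m) (seg u 1 m)"
    using P(2) by (simp add: word_function_fam seg_eq_Nil map_seg)
  have "insertion labelled_lact labelled_ract False ?F ?G (seg ?y 1 (m + 0))
    = (\<Sum>i = 1..m. ?F (?w i (lact a (u i)))) - (\<Sum>i = 1..m. ?F (?w i (ract (u i) a))) + ?F (seg ?y 1 m) * a"
    unfolding labelled.insertion_seg[OF ml[OF C(1)] D(2), of ?y m]
    by (simp add: word_function_deg0 seg_eq_Nil)
  also have "\<dots> = (\<Sum>i = 1..m. ?F (?w i (lact a (u i) - ract (u i) a))) + ?F (seg ?y 1 m) * a"
  proof -
    have "?F (?w i (lact a (u i) - ract (u i) a)) = ?F (?w i (lact a (u i))) - ?F (?w i (ract (u i) a))" for i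
      using multilinearD[OF ml[OF C(1)], of "- 1" "(x i, ract (u i) a)" "(x i, lact a (u i))"
          "(x i, lact a (u i) - ract (u i) a)" "seg ?y 1 (i - 1)" "seg ?y (i + 1) m"]
      by (simp add: labelled_comb_def)
    then show ?thesis by (simp add: sum_subtractf)
  qed
  also have "(\<Sum>i = 1..m. ?F (?w i (lact a (u i) - ract (u i) a))) = (\<Sum>i = 1..m. ev scaleM P (seg x 1 m)
            (seg u 1 (i - 1) @ [lact a (u i) - ract (u i) a] @ seg u (i + 1) m))"
  proof (intro sum.cong refl)
    fix i assume i: "i \<in> {1..m}"
    then have "i - 1 \<le> m" "i \<le> m" "1 \<le> i" by auto
    then have "seg x 1 m = seg x 1 (i - 1) @ x i # seg x (i + 1) m"
      using seg_append[of 1 "i - 1" m x] seg_Cons[of i m x] by simp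
    then show "?F (?w i (lact a (u i) - ract (u i) a)) = ev scaleM P (seg x 1 m)
            (seg u 1 (i - 1) @ [lact a (u i) - ract (u i) a] @ seg u (i + 1) m)"
      by (simp add: word_function_fam map_seg)
  qed
  finally have 1: "insertion labelled_lact labelled_ract False ?F ?G (seg ?y 1 m)
    = (\<Sum>i = 1..m. ev scaleM P (seg x 1 m)
            (seg u 1 (i - 1) @ [lact a (u i) - ract (u i) a] @ seg u (i + 1) m))
      + ev scaleM P (seg x 1 m) (seg u 1 m) * a"
    by (simp only: F add_0_right)
  have 2: "insertion labelled_lact labelled_ract False ?G ?F (seg ?y 1 m)
    = a * ev scaleM P (seg x 1 m) (seg u 1 m)"
    using labelled.insertion_seg[OF ml[OF D(1)] C(2), of ?y 0] F
    by (simp add: word_function_deg0 seg_eq_Nil)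
  have "ev scaleM (snd (cochain_bracket (fam P) (deg0 a))) (seg x 1 m) (seg u 1 m)
    = word_function (cochain_bracket (fam P) (deg0 a)) (seg ?y 1 m)"
    using P(2) by (simp add: word_function_def seg_eq_Nil map_seg)
  also have "\<dots> = insertion labelled_lact labelled_ract False ?F ?G (seg ?y 1 m)
      - insertion labelled_lact labelled_ract False ?G ?F (seg ?y 1 m)"
    unfolding word_function_cochain_bracket[OF C(1) D(1)] bracket_def
      labelled.insertion_twisted_homogeneous[OF ml[OF D(1)] D(2) C(2)] by simp
  finally show ?thesis by (simp only: 1 2)
qed

lemma cochain_bracket_algebra:
  "cochain_bracket (deg0 a) (deg0 b) = (deg0 (a * b - b * a) :: ('k, 'm, 'a, 'x) cochain)"
proof (rule cochain_eqI)
  note D = algebra_cochain[where 'x = 'x]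
  show "cochain_bracket (deg0 a) (deg0 b) \<in> (cochains :: ('k, 'm, 'a, 'x) cochain set)"
    "(deg0 (a * b - b * a) :: ('k, 'm, 'a, 'x) cochain) \<in> cochains"
    using D by (auto intro: cochain_bracket_in_cochains)
  have nil: "splits [] = {([], [], [])}" by (auto simp: splits_def)
  show "word_function (cochain_bracket (deg0 a) (deg0 b))
      = word_function (deg0 (a * b - b * a) :: ('k, 'm, 'a, 'x) cochain)"
  proof
    fix w :: "('x \<times> 'm) list"
    show "word_function (cochain_bracket (deg0 a) (deg0 b)) w
      = word_function (deg0 (a * b - b * a) :: ('k, 'm, 'a, 'x) cochain) w"
    proof (cases "w = []")
      case True
      then show ?thesis
        by (simp add: word_function_cochain_bracket[OF D(1) D(1)] bracket_def insertion_def nil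
            next_insertion_def previous_insertion_def word_function_deg0)
    next
      case False
      then show ?thesis
        using of_degreeD[OF labelled.bracket_of_degree[OF multilinear_word_function[OF D(1)[of a]] D(2)
            multilinear_word_function[OF D(1)[of b]] D(2)], of w]
        by (simp add: word_function_cochain_bracket[OF D(1) D(1)] word_function_deg0)
    qed
  qed
qed

end

section \<open>The graded Lie algebra\<close>

theorem theorem4p1:
  fixes scaleA :: "'k::comm_ring_1 \<Rightarrow> 'a::ring \<Rightarrow> 'a"
    and scaleM :: "'k \<Rightarrow> 'm::ab_group_add \<Rightarrow> 'm"
    and lact :: "'a \<Rightarrow> 'm \<Rightarrow> 'm"
    and ract :: "'m \<Rightarrow> 'a \<Rightarrow> 'm"
  assumes "CHAR('k) \<noteq> 2"
    and "associative_algebra scaleA"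
    and "bimodule scaleA scaleM lact ract"
  shows "\<exists>br :: ('k, 'm, 'a, 'x) cochain \<Rightarrow> ('k, 'm, 'a, 'x) cochain \<Rightarrow> ('k, 'm, 'a, 'x) cochain.
    graded_lie_algebra (cochain_scale scaleA) (graded_component scaleM scaleA) br \<and>
    (\<forall>m \<ge> 1. \<forall>n \<ge> 1. \<forall>P \<in> family_space scaleM scaleA m. \<forall>Q \<in> family_space scaleM scaleA n.
      \<forall>(x :: nat \<Rightarrow> 'x) (u :: nat \<Rightarrow> 'm).
      ev scaleM (snd (br (fam P) (fam Q))) (seg x 1 (m + n)) (seg u 1 (m + n)) =
        (\<Sum>i = 1..m. scaleA ((- 1) ^ ((i - 1) * n))
          (ev scaleM P (seg x 1 (i - 1) @ seg x (i + n) (m + n))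
            (seg u 1 (i - 1)
              @ [lact (ev scaleM Q (seg x i (i + n - 1)) (seg u i (i + n - 1))) (u (i + n))]
              @ seg u (i + n + 1) (m + n))))
        - (\<Sum>i = 1..m. scaleA ((- 1) ^ (i * n))
          (ev scaleM P (seg x 1 i @ seg x (i + n + 1) (m + n))
            (seg u 1 (i - 1)
              @ [ract (u i) (ev scaleM Q (seg x (i + 1) (i + n)) (seg u (i + 1) (i + n)))]
              @ seg u (i + n + 1) (m + n))))
        - scaleA ((- 1) ^ (m * n))
          ((\<Sum>i = 1..n. scaleA ((- 1) ^ ((i - 1) * m))
            (ev scaleM Q (seg x 1 (i - 1) @ seg x (i + m) (m + n))
              (seg u 1 (i - 1)
                @ [lact (ev scaleM P (seg x i (i + m - 1)) (seg u i (i + m - 1))) (u (i + m))]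
                @ seg u (i + m + 1) (m + n))))
          - (\<Sum>i = 1..n. scaleA ((- 1) ^ (i * m))
            (ev scaleM Q (seg x 1 i @ seg x (i + m + 1) (m + n))
              (seg u 1 (i - 1)
                @ [ract (u i) (ev scaleM P (seg x (i + 1) (i + m)) (seg u (i + 1) (i + m)))]
                @ seg u (i + m + 1) (m + n)))))
        + scaleA ((- 1) ^ (m * n))
          (ev scaleM P (seg x 1 m) (seg u 1 m)
              * ev scaleM Q (seg x (m + 1) (m + n)) (seg u (m + 1) (m + n))
            - scaleA ((- 1) ^ (m * n))
              (ev scaleM Q (seg x 1 n) (seg u 1 n)
                * ev scaleM P (seg x (n + 1) (m + n)) (seg u (n + 1) (m + n))))) \<and>
    (\<forall>m \<ge> 1. \<forall>P \<in> family_space scaleM scaleA m. \<forall>a.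
      (\<forall>(x :: nat \<Rightarrow> 'x) (u :: nat \<Rightarrow> 'm).
        ev scaleM (snd (br (fam P) (deg0 a))) (seg x 1 m) (seg u 1 m) =
          (\<Sum>i = 1..m. ev scaleM P (seg x 1 m)
            (seg u 1 (i - 1) @ [lact a (u i) - ract (u i) a] @ seg u (i + 1) m))
          + ev scaleM P (seg x 1 m) (seg u 1 m) * a
          - a * ev scaleM P (seg x 1 m) (seg u 1 m)) \<and>
      br (deg0 a) (fam P) = - br (fam P) (deg0 a)) \<and>
    (\<forall>a b. br (deg0 a) (deg0 b) = deg0 (a * b - b * a))"
proof -
  interpret bimodule scaleA scaleM lact ract by fact
  interpret lie: graded_lie_algebra "cochain_scale scaleA"
    "graded_component scaleM scaleA :: nat \<Rightarrow> ('k, 'm, 'a, 'x) cochain set" cochain_bracket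
    by (rule graded_lie_algebra_cochain_bracket)
  have skew: "cochain_bracket (deg0 a) (fam P) = - cochain_bracket (fam P) (deg0 a)"
    if "P \<in> family_space scaleM scaleA m" "m \<ge> 1" for a m and P :: "('k, 'm, 'a, 'x) labelled_family"
    using lie.graded_skew_symmetric[of "deg0 a" 0 "fam P" m] that
    by (simp add: graded_component_def)
  show ?thesis
    apply (rule exI[of _ cochain_bracket])
    apply (intro conjI allI ballI impI)
    apply (rule graded_lie_algebra_cochain_bracket)
    \<comment> \<open>The two insertions in the bracket have the index formula for \<open>(P, Q)\<close> and for \<open>(Q, P)\<close>.\<close>
    subgoal for m n P Q x u
      unfolding cochain_bracket_families insertion_families[of P m Q n x u] insertion_families[of Q n P m x u]
      by (simp add: add.commute[of n m] mult.commute[of n m] alg.scale_right_distrib alg.scale_right_diff_distrib algebra_simps)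
    apply (rule cochain_bracket_family_algebra; assumption)
    apply (rule skew; assumption)
    apply (rule cochain_bracket_algebra)
    done
qed

end
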